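(* Let $n\ge 3$, let $\mathcal{H}_1,\dots,\mathcal{H}_n$ be finite-dimensional complex Hilbert spaces with $\dim\mathcal{H}_i\ge 3$ for all $i$, and let $\mathcal{S}$ be a complete orthogonal product basis of $\mathcal{H}_1\otimes\mathcal{H}_2\otimes\cdots\otimes\mathcal{H}_n$ which is distinguishable by LOCC (among the $n$ parties). Then $\mathcal{S}$ is strongly local. In other words, $\mathcal{S}$ is not activable under (orthogonality-preserving) LPCC in any bipartition of the subsystems.
   Context: A complete orthogonal product basis of $\mathcal{H}_1\otimes\cdots\otimes\mathcal{H}_n$ is an orthonormal basis of this space all of whose elements are fully product vectors $|\alpha_i\rangle_1\otimes|\beta_i\rangle_2\otimes\cdots\otimes|\gamma_i\rangle_n$. A finite set of pairwise orthogonal states shared between spatially separated parties (one tensor factor per party) is locally distinguishable (distinguishable by LOCC) if, when one state is secretly chosen from the known set, the parties can identify it perfectly using only local quantum operations (local measurements) and classical communication (LOCC); otherwise it is locally indistinguishable. A bipartition $A|B$ is a partition of $\{1,\dots,n\}$ into two disjoint nonempty subsets $A,B$ with $A\cup B=\{1,\dots,n\}$; in this bipartition the system is regarded as a two-party system $\mathcal{H}_A\otimes\mathcal{H}_B$ with $\mathcal{H}_A=\bigotimes_{i\in A}\mathcal{H}_i$ and $\mathcal{H}_B=\bigotimes_{i\in B}\mathcal{H}_i$, and "local" refers to these two parties (arbitrary joint operations within $A$, and within $B$, are local). A local projective measurement by party $A$ is a family $\{P_k\}$ of orthogonal projectors on $\mathcal{H}_A$ with $P_kP_l=0$ for $k\neq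 l$ and $\sum_k P_k=\mathbb{I}$; outcome $k$ sends a state $|\psi\rangle$ to the (unnormalized) post-measurement state $(P_k\otimes\mathbb{I})|\psi\rangle$. Measurements by party $B$ are defined analogously. Such a measurement is orthogonality-preserving for a set of pairwise orthogonal states if, for every outcome $k$, the post-measurement states of the set are pairwise orthogonal. An (orthogonality-preserving) LPCC protocol (local projective measurements with classical communication) is a finite sequence of steps; at each step one party, chosen possibly depending on the previous outcomes, performs a local projective measurement (also possibly depending on previous outcomes) that is orthogonality-preserving for the current set of states, and the outcome is communicated to the other party. The current set is then replaced by the set of nonzero post-measurement states for that outcome (normalized). A set that is locally distinguishable in the bipartition $A|B$ is activable under LPCC in that bipartition if there is an orthogonality-preserving LPCC protocol between $A$ and $B$ and a sequence of outcomes after which the set of remaining nonzero post-measurement states is locally indistinguishable (by LOCC between $A$ and $B$). A set of orthogonal product states in $\bigotimes_{i=1}^n\mathcal{H}_i$, with $n\ge3$ and $\dim\mathcal{H}_i\ge3$ for all $i$, is strongly local if it is not activable in any bipartition of the parties, activability being understood here under LPCC. *)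

theory Defs
  imports Complex_Main "HOL-Library.FuncSet"
begin

text \<open>
  The parties are the numbers below \<open>n\<close>, and party \<open>i\<close> holds the Hilbert space of dimension
  \<open>d i\<close>, coordinatised with respect to an orthonormal basis.  For a set \<open>G\<close> of parties the
  tensor product of their spaces has the product basis labelled by \<open>labels G d\<close>; its vectors
  are the functions supported on these labels, and operators are given by their matrices.
\<close>

type_synonym label = "nat \<Rightarrow> nat"
type_synonym ket = "label \<Rightarrow> complex"
type_synonym operator = "label \<Rightarrow> label \<Rightarrow> complex"

definition labels :: "nat set \<Rightarrow> (nat \<Rightarrow> nat) \<Rightarrow> label set" where
  "labels G d = (\<Pi>\<^sub>E i\<in>G. {..<d i})"

definition hilbert :: "nat \<Rightarrow> (nat \<Rightarrow> nat) \<Rightarrow> ket set" where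
  "hilbert n d = {\<psi>. \<forall>x. x \<notin> labels {..<n} d \<longrightarrow> \<psi> x = 0}"

definition inner_prod :: "nat \<Rightarrow> (nat \<Rightarrow> nat) \<Rightarrow> ket \<Rightarrow> ket \<Rightarrow> complex" where
  "inner_prod n d \<phi> \<psi> = (\<Sum>x\<in>labels {..<n} d. cnj (\<phi> x) * \<psi> x)"

definition normalize_ket :: "nat \<Rightarrow> (nat \<Rightarrow> nat) \<Rightarrow> ket \<Rightarrow> ket" where
  "normalize_ket n d \<psi> = (\<lambda>x. \<psi> x / of_real (sqrt (Re (inner_prod n d \<psi> \<psi>))))"

definition orthonormal :: "nat \<Rightarrow> (nat \<Rightarrow> nat) \<Rightarrow> ket set \<Rightarrow> bool" where
  "orthonormal n d S \<longleftrightarrow>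
     S \<subseteq> hilbert n d \<and> (\<forall>\<phi>\<in>S. \<forall>\<psi>\<in>S. inner_prod n d \<phi> \<psi> = (if \<phi> = \<psi> then 1 else 0))"

definition product_ket :: "nat \<Rightarrow> (nat \<Rightarrow> nat) \<Rightarrow> (nat \<Rightarrow> nat \<Rightarrow> complex) \<Rightarrow> ket" where
  "product_ket n d \<alpha> = (\<lambda>x. if x \<in> labels {..<n} d then \<Prod>i<n. \<alpha> i (x i) else 0)"

definition orthogonal_product_set :: "nat \<Rightarrow> (nat \<Rightarrow> nat) \<Rightarrow> ket set \<Rightarrow> bool" where
  "orthogonal_product_set n d S \<longleftrightarrow>
     finite S \<and> orthonormal n d S \<and> (\<forall>\<psi>\<in>S. \<exists>\<alpha>. \<psi> = product_ket n d \<alpha>)"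

definition complete_orthogonal_product_basis ::
    "nat \<Rightarrow> (nat \<Rightarrow> nat) \<Rightarrow> ket set \<Rightarrow> bool" where
  "complete_orthogonal_product_basis n d S \<longleftrightarrow>
     orthogonal_product_set n d S \<and>
     (\<forall>\<psi>\<in>hilbert n d. \<exists>c. \<psi> = (\<lambda>x. \<Sum>\<phi>\<in>S. c \<phi> * \<phi> x))"

definition adj :: "operator \<Rightarrow> operator" where
  "adj K = (\<lambda>x y. cnj (K y x))"

text \<open>Matrix product; \<open>D\<close> is the set of labels of the space in the middle.\<close>

definition op_comp :: "label set \<Rightarrow> operator \<Rightarrow> operator \<Rightarrow> operator" where
  "op_comp D K L = (\<lambda>x y. \<Sum>z\<in>D. K x z * L z y)"

text \<open>
  \<open>act n G d e K \<psi>\<close> is the vector obtained from \<open>\<psi>\<close> by applying \<open>K\<close> to the parties in \<open>G\<close>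
  and the identity to the others.  Here \<open>K\<close> maps the space of \<open>G\<close> with dimensions \<open>d\<close> to the
  one with dimensions \<open>e\<close>, where \<open>e\<close> and \<open>d\<close> agree outside \<open>G\<close>.
\<close>

definition act ::
    "nat \<Rightarrow> nat set \<Rightarrow> (nat \<Rightarrow> nat) \<Rightarrow> (nat \<Rightarrow> nat) \<Rightarrow> operator \<Rightarrow> ket \<Rightarrow> ket" where
  "act n G d e K \<psi> = (\<lambda>x. if x \<in> labels {..<n} e
     then \<Sum>y\<in>labels G d. K (restrict x G) y * \<psi> (override_on x y G) else 0)"

text \<open>
  \<open>labs\<close> is a partition of the parties: the parties in one block may act jointly.  Thus
  \<open>all_separated n\<close> is the situation of \<open>n\<close> separated parties and \<open>{A, B}\<close> that of the
  bipartition \<open>A|B\<close>.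
\<close>

definition all_separated :: "nat \<Rightarrow> nat set set" where
  "all_separated n = (\<lambda>i. {i}) ` {..<n}"

definition bipartition :: "nat \<Rightarrow> nat set \<Rightarrow> nat set \<Rightarrow> bool" where
  "bipartition n A B \<longleftrightarrow> A \<noteq> {} \<and> B \<noteq> {} \<and> A \<inter> B = {} \<and> A \<union> B = {..<n}"

text \<open>
  A general quantum measurement on the space of \<open>G\<close> with outcomes \<open>k < m\<close>.  The Kraus operator
  \<open>K k\<close> may have any finite-dimensional output space, so that ancillas are covered.
\<close>

definition measurement ::
    "nat set \<Rightarrow> (nat \<Rightarrow> nat) \<Rightarrow> nat \<Rightarrow> (nat \<Rightarrow> nat \<Rightarrow> nat) \<Rightarrow> (nat \<Rightarrow> operator) \<Rightarrow> bool" where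
  "measurement G d m e K \<longleftrightarrow>
     (\<forall>k<m. \<forall>i. i \<notin> G \<longrightarrow> e k i = d i) \<and>
     (\<forall>x\<in>labels G d. \<forall>y\<in>labels G d.
        (\<Sum>k<m. op_comp (labels G (e k)) (adj (K k)) (K k) x y) = (if x = y then 1 else 0))"

text \<open>
  A finite-round LOCC protocol: either the parties announce which state they were given, or the
  block \<open>G\<close> performs a measurement, broadcasts the outcome \<open>k\<close>, and the protocol goes on with
  the \<open>k\<close>-th subprotocol.
\<close>

datatype locc =
    Announce ket
  | Local_Measurement "nat set" nat "nat \<Rightarrow> nat \<Rightarrow> nat" "nat \<Rightarrow> operator" "nat \<Rightarrow> locc"

text \<open>
  \<open>v \<psi>\<close> is the current, unnormalised state if the initial state was \<open>\<psi>\<close>.  It is zero exactly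
  if the present sequence of outcomes has probability zero for \<open>\<psi>\<close>.  Perfect identification
  means that a wrong announcement has probability zero.
\<close>

primrec identifies ::
    "nat \<Rightarrow> nat set set \<Rightarrow> ket set \<Rightarrow> locc \<Rightarrow> (nat \<Rightarrow> nat) \<Rightarrow> (ket \<Rightarrow> ket) \<Rightarrow> bool" where
  "identifies n labs S (Announce \<phi>) d v \<longleftrightarrow> (\<forall>\<psi>\<in>S. \<psi> \<noteq> \<phi> \<longrightarrow> v \<psi> = (\<lambda>_. 0))"
| "identifies n labs S (Local_Measurement G m e K cont) d v \<longleftrightarrow>
     G \<in> labs \<and> measurement G d m e K \<and>
     (\<forall>k<m. identifies n labs S (cont k) (e k) (\<lambda>\<psi>. act n G d (e k) (K k) (v \<psi>)))"

definition locally_distinguishable ::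
    "nat \<Rightarrow> (nat \<Rightarrow> nat) \<Rightarrow> nat set set \<Rightarrow> ket set \<Rightarrow> bool" where
  "locally_distinguishable n d labs S \<longleftrightarrow> (\<exists>p. identifies n labs S p d (\<lambda>\<psi>. \<psi>))"

definition projective_measurement ::
    "nat set \<Rightarrow> (nat \<Rightarrow> nat) \<Rightarrow> nat \<Rightarrow> (nat \<Rightarrow> operator) \<Rightarrow> bool" where
  "projective_measurement G d m P \<longleftrightarrow>
     (\<forall>x\<in>labels G d. \<forall>y\<in>labels G d.
        (\<forall>k<m. adj (P k) x y = P k x y) \<and>
        (\<forall>k<m. \<forall>l<m. op_comp (labels G d) (P k) (P l) x y = (if k = l then P k x y else 0)) \<and>
        (\<Sum>k<m. P k x y) = (if x = y then 1 else 0))"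

definition orthogonality_preserving ::
    "nat \<Rightarrow> (nat \<Rightarrow> nat) \<Rightarrow> nat set \<Rightarrow> nat \<Rightarrow> (nat \<Rightarrow> operator) \<Rightarrow> ket set \<Rightarrow> bool" where
  "orthogonality_preserving n d G m P S \<longleftrightarrow>
     (\<forall>k<m. \<forall>\<phi>\<in>S. \<forall>\<psi>\<in>S. \<phi> \<noteq> \<psi> \<longrightarrow>
        inner_prod n d (act n G d d (P k) \<phi>) (act n G d d (P k) \<psi>) = 0)"

definition post_states ::
    "nat \<Rightarrow> (nat \<Rightarrow> nat) \<Rightarrow> nat set \<Rightarrow> operator \<Rightarrow> ket set \<Rightarrow> ket set" where
  "post_states n d G P S = normalize_ket n d ` (act n G d d P ` S - {\<lambda>_. 0})"

datatype lpcc =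
    Stop
  | Project "nat set" nat "nat \<Rightarrow> operator" "nat \<Rightarrow> lpcc"

primrec op_lpcc_protocol ::
    "nat \<Rightarrow> (nat \<Rightarrow> nat) \<Rightarrow> nat set set \<Rightarrow> lpcc \<Rightarrow> ket set \<Rightarrow> bool" where
  "op_lpcc_protocol n d labs Stop S \<longleftrightarrow> True"
| "op_lpcc_protocol n d labs (Project G m P cont) S \<longleftrightarrow>
     G \<in> labs \<and> projective_measurement G d m P \<and> orthogonality_preserving n d G m P S \<and>
     (\<forall>k<m. op_lpcc_protocol n d labs (cont k) (post_states n d G (P k) S))"

text \<open>The sets of remaining states for all complete sequences of outcomes of a protocol.\<close>

primrec remaining_sets ::
    "nat \<Rightarrow> (nat \<Rightarrow> nat) \<Rightarrow> lpcc \<Rightarrow> ket set \<Rightarrow> ket set set" where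
  "remaining_sets n d Stop S = {S}"
| "remaining_sets n d (Project G m P cont) S =
     (\<Union>k<m. remaining_sets n d (cont k) (post_states n d G (P k) S))"

definition activable ::
    "nat \<Rightarrow> (nat \<Rightarrow> nat) \<Rightarrow> nat set \<Rightarrow> nat set \<Rightarrow> ket set \<Rightarrow> bool" where
  "activable n d A B S \<longleftrightarrow>
     locally_distinguishable n d {A, B} S \<and>
     (\<exists>p. op_lpcc_protocol n d {A, B} p S \<and>
        (\<exists>T\<in>remaining_sets n d p S. \<not> locally_distinguishable n d {A, B} T))"

text \<open>
  Activability is a notion for sets that are locally distinguishable in the bipartition.  This
  presupposition is made explicit here: otherwise a set that is locally indistinguishable in
  every bipartition would be strongly local for trivial reasons.
\<close>

definition strongly_local :: "nat \<Rightarrow> (nat \<Rightarrow> nat) \<Rightarrow> ket set \<Rightarrow> bool" where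
  "strongly_local n d S \<longleftrightarrow>
     3 \<le> n \<and> (\<forall>i<n. 3 \<le> d i) \<and> orthogonal_product_set n d S \<and>
     (\<forall>A B. bipartition n A B \<longrightarrow>
        locally_distinguishable n d {A, B} S \<and> \<not> activable n d A B S)"

end

(*
  Write S for the basis and A|B for the bipartition. After an orthogonality-preserving LPCC
  protocol the remaining states are, up to normalisation, the nonzero vectors (W (x) V) phi with
  phi in S, where W and V are partial isometries of A and B, and these vectors are pairwise
  orthogonal. This is preserved by a projection P of A: put K = P W, M = K^* K and Q = V^* V. The
  vectors (K (x) V) phi are pairwise orthogonal, so M (x) Q is diagonal in the complete basis S.
  Hence K may be replaced by the partial isometry K M^(-1/2), which only rescales the states.
  Finally A and B can undo W and V locally: W^* W (x) V^* V is diagonal in S as well, so this turns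
  the remaining states back into multiples of elements of S, which are then identified by the
  original protocol.
*)

theory Submission
  imports Defs
begin

section \<open>Labels and local operators\<close>

text \<open>A product of projections cannot in general be undone by a measurement without a chance
  of failure. A partial isometry \<open>W\<close> can, by the Kraus operators \<open>adj W\<close>
  and 1 - \<open>W\<close> \<open>adj W\<close>; this is why partial isometries are carried along.
  Completeness matters because a vector orthogonal to all elements of \<open>S\<close> but one is a
  multiple of that one, which turns orthogonality of the images into an eigenvalue equation. The
  delicate point is that this equation concerns M \<otimes> Q, while the correction has to act on A
  alone. Since Q is a projection, sums and products of operators of the form X \<otimes> Q keep that
  form, and so does every polynomial in M \<otimes> Q without constant term. Interpolation at the
  finitely many eigenvalues then gives M^(-1/2) \<otimes> Q, with 0 sent to 0, without the spectral
  theorem. Keeping V a partial isometry as well is what makes Q a projection. The identity that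
  makes W a partial isometry is first checked on \<open>S\<close> after tensoring with V, and a
  nonzero V is then cancelled.\<close>

lemma finite_labels [simp]: "finite G \<Longrightarrow> finite (labels G d)"
  unfolding labels_def by (intro finite_PiE) auto

lemma restrict_labels:
  assumes "x \<in> labels N d" "G \<subseteq> N"
  shows "restrict x G \<in> labels G d"
  using assms unfolding labels_def by (auto simp: PiE_iff)

lemma override_labels:
  assumes "x \<in> labels N d" "y \<in> labels G e" "G \<subseteq> N" "\<forall>i\<in>N - G. d i = e i"
  shows "override_on x y G \<in> labels N e"
  using assms unfolding labels_def
  by (auto simp: PiE_iff override_on_def extensional_def subset_iff)

lemma restrict_override [simp]:
  "y \<in> labels G d \<Longrightarrow> restrict (override_on x y G) G = y"
  unfolding labels_def by (auto simp: PiE_iff override_on_def extensional_def fun_eq_iff)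

lemma override_override [simp]: "override_on (override_on x y G) z G = override_on x z G"
  by (auto simp: override_on_def fun_eq_iff)

lemma override_restrict_self [simp]: "override_on x (restrict x G) G = x"
  by (auto simp: override_on_def fun_eq_iff)

lemma restrict_override_disjoint:
  "G \<inter> G' = {} \<Longrightarrow> restrict (override_on x y G) G' = restrict x G'"
  by (auto simp: override_on_def fun_eq_iff restrict_def)

lemma override_override_disjoint:
  "G \<inter> G' = {} \<Longrightarrow>
    override_on (override_on x y G) z G' = override_on (override_on x z G') y G"
  by (auto simp: override_on_def fun_eq_iff)

lemma act_in_hilbert [simp]: "act n G d d K \<psi> \<in> hilbert n d"
  unfolding act_def hilbert_def by auto

lemma act_compose:
  assumes "G \<subseteq> {..<n}"
  shows "act n G d d K (act n G d d L \<psi>) = act n G d d (op_comp (labels G d) K L) \<psi>"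
proof
  fix x
  show "act n G d d K (act n G d d L \<psi>) x = act n G d d (op_comp (labels G d) K L) \<psi> x"
  proof (cases "x \<in> labels {..<n} d")
    case True
    have "act n G d d L \<psi> (override_on x y G)
        = (\<Sum>z\<in>labels G d. L y z * \<psi> (override_on x z G))" if "y \<in> labels G d" for y
      using override_labels[OF True that assms] that by (simp add: act_def)
    then have "act n G d d K (act n G d d L \<psi>) x
        = (\<Sum>y\<in>labels G d. \<Sum>z\<in>labels G d.
             K (restrict x G) y * (L y z * \<psi> (override_on x z G)))"
      using True by (simp add: act_def[of n G d d K] sum_distrib_left)
    also have "\<dots> = act n G d d (op_comp (labels G d) K L) \<psi> x"
      using True
      by (subst sum.swap) (simp add: act_def op_comp_def sum_distrib_right mult.assoc)
    finally show ?thesis .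
  qed (simp add: act_def)
qed

lemma act_commute:
  assumes "G \<subseteq> {..<n}" "G' \<subseteq> {..<n}" "G \<inter> G' = {}"
  shows "act n G d d K (act n G' d d L \<psi>) = act n G' d d L (act n G d d K \<psi>)"
proof
  fix x
  have sym: "G' \<inter> G = {}"
    using assms(3) by blast
  show "act n G d d K (act n G' d d L \<psi>) x = act n G' d d L (act n G d d K \<psi>) x"
  proof (cases "x \<in> labels {..<n} d")
    case True
    have 1: "act n G' d d L \<psi> (override_on x y G)
        = (\<Sum>z\<in>labels G' d. L (restrict x G') z * \<psi> (override_on (override_on x y G) z G'))"
      if "y \<in> labels G d" for y
      using override_labels[OF True that assms(1)]
      by (simp add: act_def restrict_override_disjoint[OF assms(3)])
    have 2: "act n G d d K \<psi> (override_on x z G')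
        = (\<Sum>y\<in>labels G d. K (restrict x G) y * \<psi> (override_on (override_on x y G) z G'))"
      if "z \<in> labels G' d" for z
      using override_labels[OF True that assms(2)]
      by (simp add: act_def restrict_override_disjoint[OF sym]
          override_override_disjoint[OF sym])
    have "act n G d d K (act n G' d d L \<psi>) x
        = (\<Sum>y\<in>labels G d. \<Sum>z\<in>labels G' d. K (restrict x G) y *
            (L (restrict x G') z * \<psi> (override_on (override_on x y G) z G')))"
      using True 1 by (simp add: act_def[of n G d d K] sum_distrib_left)
    also have "\<dots> = (\<Sum>z\<in>labels G' d. \<Sum>y\<in>labels G d. L (restrict x G') z *
            (K (restrict x G) y * \<psi> (override_on (override_on x y G) z G')))"
      by (subst sum.swap) (simp add: mult.left_commute)
    also have "\<dots> = act n G' d d L (act n G d d K \<psi>) x"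
      using True 2 by (simp add: act_def[of n G' d d L] sum_distrib_left)
    finally show ?thesis .
  qed (simp add: act_def)
qed

lemma inner_act_adj:
  assumes "G \<subseteq> {..<n}"
  shows "inner_prod n d \<phi> (act n G d d K \<psi>) = inner_prod n d (act n G d d (adj K) \<phi>) \<psi>"
proof -
  let ?N = "labels {..<n} d" and ?G = "labels G d"
  have "inner_prod n d \<phi> (act n G d d K \<psi>)
      = (\<Sum>(x, y)\<in>?N \<times> ?G. cnj (\<phi> x) * (K (restrict x G) y * \<psi> (override_on x y G)))"
    by (simp add: inner_prod_def act_def sum_distrib_left sum.cartesian_product)
  also have "\<dots> = (\<Sum>(x, y)\<in>?N \<times> ?G.
      cnj (\<phi> (override_on x y G)) * (K y (restrict x G) * \<psi> x))"
    \<comment> \<open>The map exchanges the \<open>G\<close>-part of \<open>x\<close> with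
      \<open>y\<close>. It is an involution, so it serves as its own inverse.\<close>
    by (rule sum.reindex_bij_witness[where
          i = "\<lambda>(x, y). (override_on x y G, restrict x G)" and
          j = "\<lambda>(x, y). (override_on x y G, restrict x G)"])
      (use assms in \<open>auto intro!: override_labels restrict_labels\<close>)
  also have "\<dots> = inner_prod n d (act n G d d (adj K) \<phi>) \<psi>"
    by (simp add: inner_prod_def act_def adj_def sum_distrib_right sum.cartesian_product
        mult.assoc mult.left_commute)
  finally show ?thesis .
qed

lemma act_scale: "act n G d e K (\<lambda>x. a * \<psi> x) = (\<lambda>x. a * act n G d e K \<psi> x)"
  by (auto simp: act_def sum_distrib_left mult.left_commute)

lemma act_zero [simp]: "act n G d e K (\<lambda>x. 0) = (\<lambda>x. 0)"
  by (auto simp: act_def)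

lemma act_sum:
  "act n G d e K (\<lambda>x. \<Sum>t\<in>T. c t * v t x) = (\<lambda>x. \<Sum>t\<in>T. c t * act n G d e K (v t) x)"
proof
  fix x
  show "act n G d e K (\<lambda>x. \<Sum>t\<in>T. c t * v t x) x = (\<Sum>t\<in>T. c t * act n G d e K (v t) x)"
    by (simp add: act_def sum_distrib_left mult.left_commute) (subst sum.swap, simp)
qed

lemma act_lincomb:
  "act n G d e (\<lambda>x y. a * K x y + b * L x y) \<psi> =
    (\<lambda>x. a * act n G d e K \<psi> x + b * act n G d e L \<psi> x)"
  by (auto simp: act_def sum_distrib_left sum.distrib algebra_simps)

section \<open>Identity, adjoint and equality of operators\<close>

definition id_op :: operator where
  "id_op = (\<lambda>x y. if x = y then 1 else 0)"

lemma adj_adj [simp]: "adj (adj K) = K"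
  by (simp add: adj_def)

lemma adj_op_comp: "adj (op_comp D K L) = op_comp D (adj L) (adj K)"
  by (simp add: adj_def op_comp_def mult.commute)

lemma op_comp_assoc: "op_comp D (op_comp D K L) M = op_comp D K (op_comp D L M)"
  unfolding op_comp_def
  by (intro ext, simp add: sum_distrib_left sum_distrib_right mult.assoc) (subst sum.swap, simp)

lemma act_id:
  assumes "G \<subseteq> {..<n}" "\<psi> \<in> hilbert n d"
  shows "act n G d d id_op \<psi> = \<psi>"
proof
  fix x
  have fin: "finite G"
    using assms finite_subset by blast
  show "act n G d d id_op \<psi> x = \<psi> x"
  proof (cases "x \<in> labels {..<n} d")
    case True
    have "act n G d d id_op \<psi> x
        = (\<Sum>y\<in>labels G d. if restrict x G = y then \<psi> (override_on x y G) else 0)"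
      using True by (auto simp: act_def id_op_def intro!: sum.cong)
    also have "\<dots> = \<psi> x"
      using restrict_labels[OF True assms(1)] fin by simp
    finally show ?thesis .
  next
    case False
    then show ?thesis
      using assms(2) by (simp add: act_def hilbert_def)
  qed
qed

text \<open>Operators are total functions, but only the entries at labels of the space carry
  meaning; laws such as \<open>op_comp_id_left\<close> can fail elsewhere.\<close>

definition op_eq :: "nat set \<Rightarrow> (nat \<Rightarrow> nat) \<Rightarrow> operator \<Rightarrow> operator \<Rightarrow> bool" where
  "op_eq G d K L \<longleftrightarrow> (\<forall>x\<in>labels G d. \<forall>y\<in>labels G d. K x y = L x y)"

lemma op_eq_refl [simp]: "op_eq G d K K"
  by (simp add: op_eq_def)

lemma op_eq_sym: "op_eq G d K L \<Longrightarrow> op_eq G d L K"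
  by (simp add: op_eq_def)

lemma op_eq_trans: "op_eq G d K L \<Longrightarrow> op_eq G d L M \<Longrightarrow> op_eq G d K M"
  by (simp add: op_eq_def)

lemma op_eq_comp:
  "op_eq G d K K' \<Longrightarrow> op_eq G d L L' \<Longrightarrow>
    op_eq G d (op_comp (labels G d) K L) (op_comp (labels G d) K' L')"
  by (simp add: op_eq_def op_comp_def)

lemma act_cong:
  "G \<subseteq> {..<n} \<Longrightarrow> op_eq G d K L \<Longrightarrow> act n G d d K \<psi> = act n G d d L \<psi>"
  by (auto simp: act_def op_eq_def restrict_labels intro!: sum.cong)

section \<open>Inner product and normalisation\<close>

lemma inner_scale_left:
  "inner_prod n d (\<lambda>x. a * \<phi> x) \<psi> = cnj a * inner_prod n d \<phi> \<psi>"
  by (simp add: inner_prod_def sum_distrib_left mult.assoc)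

lemma inner_scale_right:
  "inner_prod n d \<phi> (\<lambda>x. a * \<psi> x) = a * inner_prod n d \<phi> \<psi>"
  by (simp add: inner_prod_def sum_distrib_left mult.left_commute)

lemma inner_sum_right:
  "inner_prod n d \<phi> (\<lambda>x. \<Sum>t\<in>T. c t * v t x) = (\<Sum>t\<in>T. c t * inner_prod n d \<phi> (v t))"
  unfolding inner_prod_def
  by (simp add: sum_distrib_left mult.left_commute) (subst sum.swap, simp)

lemma inner_zero [simp]:
  "inner_prod n d (\<lambda>x. 0) \<psi> = 0" "inner_prod n d \<phi> (\<lambda>x. 0) = 0"
  by (simp_all add: inner_prod_def)

lemma inner_self_real: "inner_prod n d \<psi> \<psi> = of_real (Re (inner_prod n d \<psi> \<psi>))"
  and inner_self_nonneg: "0 \<le> Re (inner_prod n d \<psi> \<psi>)"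
proof -
  have "inner_prod n d \<psi> \<psi> = of_real (\<Sum>x\<in>labels {..<n} d. (cmod (\<psi> x))\<^sup>2)"
    unfolding inner_prod_def of_real_sum
    by (intro sum.cong refl) (metis complex_norm_square mult.commute)
  then show "inner_prod n d \<psi> \<psi> = of_real (Re (inner_prod n d \<psi> \<psi>))"
    and "0 \<le> Re (inner_prod n d \<psi> \<psi>)"
    by (simp_all add: sum_nonneg)
qed

lemma inner_self_eq_0:
  assumes "\<psi> \<in> hilbert n d" "Re (inner_prod n d \<psi> \<psi>) = 0"
  shows "\<psi> = (\<lambda>_. 0)"
proof
  fix x
  have "Re (inner_prod n d \<psi> \<psi>) = (\<Sum>x\<in>labels {..<n} d. (cmod (\<psi> x))\<^sup>2)"
    unfolding inner_prod_def Re_sum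
    by (intro sum.cong refl) (simp add: cmod_def power2_eq_square)
  then have sum0: "(\<Sum>x\<in>labels {..<n} d. (cmod (\<psi> x))\<^sup>2) = 0"
    using assms(2) by simp
  have "\<forall>x\<in>labels {..<n} d. (cmod (\<psi> x))\<^sup>2 = 0"
    using sum_nonneg_eq_0_iff[THEN iffD1, OF _ _ sum0] by simp
  then show "\<psi> x = 0"
    using assms(1) by (cases "x \<in> labels {..<n} d") (auto simp: hilbert_def)
qed

lemma inner_self_pos:
  "\<psi> \<in> hilbert n d \<Longrightarrow> \<psi> \<noteq> (\<lambda>_. 0) \<Longrightarrow> 0 < Re (inner_prod n d \<psi> \<psi>)"
  using inner_self_eq_0 inner_self_nonneg by (metis less_eq_real_def)

text \<open>A positive factor is absorbed by the norm, whereas a phase would survive normalisation.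
  Hence the rescalings below are always by positive reals.\<close>

lemma normalize_ket_scale:
  assumes "0 < a"
  shows "normalize_ket n d (\<lambda>x. of_real a * \<psi> x) = normalize_ket n d \<psi>"
proof
  fix x
  have "Re (inner_prod n d (\<lambda>x. of_real a * \<psi> x) (\<lambda>x. of_real a * \<psi> x))
      = a * a * Re (inner_prod n d \<psi> \<psi>)"
    by (simp add: inner_scale_left inner_scale_right)
  then have "sqrt (Re (inner_prod n d (\<lambda>x. of_real a * \<psi> x) (\<lambda>x. of_real a * \<psi> x)))
      = a * sqrt (Re (inner_prod n d \<psi> \<psi>))"
    using assms by (simp add: real_sqrt_mult)
  then show "normalize_ket n d (\<lambda>x. of_real a * \<psi> x) x = normalize_ket n d \<psi> x"
    using assms by (simp add: normalize_ket_def)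
qed

lemma normalize_ket_eq_scale:
  assumes "\<psi> \<in> hilbert n d" "\<psi> \<noteq> (\<lambda>_. 0)"
  obtains a where "0 < a" "normalize_ket n d \<psi> = (\<lambda>x. of_real a * \<psi> x)"
proof
  show "0 < 1 / sqrt (Re (inner_prod n d \<psi> \<psi>))"
    using inner_self_pos[OF assms] by simp
  show "normalize_ket n d \<psi> = (\<lambda>x. of_real (1 / sqrt (Re (inner_prod n d \<psi> \<psi>))) * \<psi> x)"
    by (simp add: normalize_ket_def)
qed

text \<open>This is the shape of \<open>post_states\<close> with an arbitrary map \<open>F\<close>,
  so that the effect of several rounds can be written as one map on the initial set.\<close>

definition normalized_image ::
    "nat \<Rightarrow> (nat \<Rightarrow> nat) \<Rightarrow> (ket \<Rightarrow> ket) \<Rightarrow> ket set \<Rightarrow> ket set" where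
  "normalized_image n d F S = normalize_ket n d ` (F ` S - {\<lambda>_. 0})"

lemma normalized_image_cong_scale:
  assumes "\<And>\<phi>. \<phi> \<in> S \<Longrightarrow> F \<phi> \<noteq> (\<lambda>_. 0) \<Longrightarrow> \<exists>a>0. F' \<phi> = (\<lambda>x. of_real a * F \<phi> x)"
    and "\<And>\<phi>. \<phi> \<in> S \<Longrightarrow> F \<phi> = (\<lambda>_. 0) \<Longrightarrow> F' \<phi> = (\<lambda>_. 0)"
  shows "normalized_image n d F' S = normalized_image n d F S"
proof -
  have *: "(F \<phi> \<noteq> (\<lambda>_. 0) \<longleftrightarrow> F' \<phi> \<noteq> (\<lambda>_. 0)) \<and>
      normalize_ket n d (F' \<phi>) = normalize_ket n d (F \<phi>)" if \<phi>: "\<phi> \<in> S" for \<phi>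
  proof (cases "F \<phi> = (\<lambda>_. 0)")
    case True
    then show ?thesis
      using assms(2) \<phi> by simp
  next
    case False
    then obtain a where a: "a > 0" "F' \<phi> = (\<lambda>x. of_real a * F \<phi> x)"
      using assms(1)[OF \<phi> False] by auto
    then have "F' \<phi> \<noteq> (\<lambda>_. 0)"
      using False by (auto simp: fun_eq_iff)
    then show ?thesis
      using False a by (simp add: normalize_ket_scale)
  qed
  have eq: "normalized_image n d F S = (\<lambda>\<phi>. normalize_ket n d (F \<phi>)) ` {\<phi>\<in>S. F \<phi> \<noteq> (\<lambda>_. 0)}"
    for F
    unfolding normalized_image_def by blast
  show ?thesis
    unfolding eq by (rule image_cong) (use * in auto)
qed

text \<open>Normalising and discarding zero vectors between two rounds can be postponed:
  \<open>act\<close> is linear, so an earlier positive factor disappears in the later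
  normalisation.\<close>

lemma post_states_normalized_image:
  assumes "\<And>\<phi>. \<phi> \<in> S \<Longrightarrow> F \<phi> \<in> hilbert n d"
  shows "post_states n d G P (normalized_image n d F S)
    = normalized_image n d (\<lambda>\<phi>. act n G d d P (F \<phi>)) S"
proof -
  \<comment> \<open>The image of \<open>N\<close> on \<open>S\<close> and the normalised set differ
    at most by the zero vector, which \<open>act\<close> sends to zero.\<close>
  define N where "N = (\<lambda>\<phi>. if F \<phi> = (\<lambda>_. 0) then (\<lambda>_. 0) else normalize_ket n d (F \<phi>))"
  have "post_states n d G P (normalized_image n d F S)
      = normalized_image n d (\<lambda>\<phi>. act n G d d P (N \<phi>)) S"
  proof -
    have 1: "N ` S - {\<lambda>_. 0} \<subseteq> normalize_ket n d ` (F ` S - {\<lambda>_. 0})"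
    proof
      fix \<psi> assume "\<psi> \<in> N ` S - {\<lambda>_. 0}"
      then obtain \<phi> where "\<phi> \<in> S" "\<psi> = N \<phi>" "\<psi> \<noteq> (\<lambda>_. 0)"
        by blast
      then have "\<psi> = normalize_ket n d (F \<phi>)" "F \<phi> \<in> F ` S - {\<lambda>_. 0}"
        by (auto simp: N_def split: if_splits)
      then show "\<psi> \<in> normalize_ket n d ` (F ` S - {\<lambda>_. 0})"
        by (rule image_eqI)
    qed
    have 2: "normalize_ket n d ` (F ` S - {\<lambda>_. 0}) \<subseteq> N ` S"
    proof
      fix \<psi> assume "\<psi> \<in> normalize_ket n d ` (F ` S - {\<lambda>_. 0})"
      then obtain \<phi> where "\<phi> \<in> S" "F \<phi> \<noteq> (\<lambda>_. 0)" "\<psi> = normalize_ket n d (F \<phi>)"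
        by blast
      then have "\<psi> = N \<phi>" "\<phi> \<in> S"
        by (simp_all add: N_def)
      then show "\<psi> \<in> N ` S"
        by (rule image_eqI)
    qed
    have "act n G d d P ` (normalize_ket n d ` (F ` S - {\<lambda>_. 0})) - {\<lambda>_. 0}
        = act n G d d P ` N ` S - {\<lambda>_. 0}" (is "?l = ?r")
    proof
      show "?l \<subseteq> ?r"
        using image_mono[OF 2] by (rule Diff_mono) simp
      have "act n G d d P ` N ` S - {\<lambda>_. 0} \<subseteq> act n G d d P ` (N ` S - {\<lambda>_. 0})"
      proof
        fix \<psi> assume \<psi>: "\<psi> \<in> act n G d d P ` N ` S - {\<lambda>_. 0}"
        then obtain \<chi> where \<chi>: "\<chi> \<in> N ` S" "\<psi> = act n G d d P \<chi>"
          by blast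
        moreover have "\<chi> \<noteq> (\<lambda>_. 0)"
          using \<psi> \<chi>(2) by auto
        ultimately show "\<psi> \<in> act n G d d P ` (N ` S - {\<lambda>_. 0})"
          by blast
      qed
      then show "?r \<subseteq> ?l"
        using image_mono[OF 1, of "act n G d d P"] by blast
    qed
    then show ?thesis
      by (simp add: post_states_def normalized_image_def image_image)
  qed
  also have "\<dots> = normalized_image n d (\<lambda>\<phi>. act n G d d P (F \<phi>)) S"
  proof (rule normalized_image_cong_scale)
    fix \<phi> assume "\<phi> \<in> S" "act n G d d P (F \<phi>) \<noteq> (\<lambda>_. 0)"
    then have "F \<phi> \<noteq> (\<lambda>_. 0)" "F \<phi> \<in> hilbert n d"
      using assms by auto
    then obtain a where "0 < a" "normalize_ket n d (F \<phi>) = (\<lambda>x. of_real a * F \<phi> x)"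
      using normalize_ket_eq_scale by blast
    then show "\<exists>a>0. act n G d d P (N \<phi>) = (\<lambda>x. of_real a * act n G d d P (F \<phi>) x)"
      using \<open>F \<phi> \<noteq> (\<lambda>_. 0)\<close> by (auto simp: N_def act_scale)
  next
    fix \<phi> assume *: "\<phi> \<in> S" "act n G d d P (F \<phi>) = (\<lambda>_. 0)"
    show "act n G d d P (N \<phi>) = (\<lambda>_. 0)"
    proof (cases "F \<phi> = (\<lambda>_. 0)")
      case False
      then obtain a where "normalize_ket n d (F \<phi>) = (\<lambda>x. of_real a * F \<phi> x)"
        using normalize_ket_eq_scale[OF assms[OF *(1)]] by blast
      then show ?thesis
        using False * by (simp add: N_def act_scale)
    qed (simp add: N_def)
  qed
  finally show ?thesis .
qed

section \<open>Simulating a protocol with coarser parties\<close>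

text \<open>This is the matrix of \<open>K\<close> tensored with the identity on
  \<open>A - G\<close>.\<close>

definition ext_op :: "nat set \<Rightarrow> nat set \<Rightarrow> operator \<Rightarrow> operator" where
  "ext_op G A K = (\<lambda>x y. if \<forall>i\<in>A - G. x i = y i then K (restrict x G) (restrict y G) else 0)"

text \<open>A label of \<open>A\<close> with prescribed values off \<open>G\<close> is determined by
  its restriction to \<open>G\<close>. Two dimension functions occur because Kraus operators may
  change the dimensions inside \<open>G\<close>.\<close>

lemma sum_labels_fixed_outside:
  assumes "finite A" "G \<subseteq> A" "x \<in> labels A e" "\<forall>i\<in>A - G. e i = d i"
  shows "(\<Sum>y\<in>labels A d. if \<forall>i\<in>A - G. x i = y i then f y else (0::complex))
    = (\<Sum>w\<in>labels G d. f (override_on x w G))"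
proof -
  have "(\<Sum>y\<in>labels A d. if \<forall>i\<in>A - G. x i = y i then f y else 0)
      = (\<Sum>y | y \<in> labels A d \<and> (\<forall>i\<in>A - G. x i = y i). f y)"
    using assms(1) by (intro sum.inter_filter[symmetric]) simp
  also have "\<dots> = (\<Sum>w\<in>labels G d. f (override_on x w G))"
  proof (rule sum.reindex_bij_witness[where i = "\<lambda>w. override_on x w G"
        and j = "\<lambda>y. restrict y G"])
    fix y assume y: "y \<in> {y \<in> labels A d. \<forall>i\<in>A - G. x i = y i}"
    show eq: "override_on x (restrict y G) G = y"
    proof
      fix i
      show "override_on x (restrict y G) G i = y i"
        using y assms(2,3) by (cases "i \<in> A") (auto simp: override_on_def labels_def PiE_iff extensional_def)
    qed
    show "restrict y G \<in> labels G d"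
      using y assms restrict_labels by blast
    show "f (override_on x (restrict y G) G) = f y"
      by (simp add: eq)
  next
    fix w assume w: "w \<in> labels G d"
    show "restrict (override_on x w G) G = w"
      using w by simp
    show "override_on x w G \<in> {y \<in> labels A d. \<forall>i\<in>A - G. x i = y i}"
      using override_labels[OF assms(3) w assms(2,4)] by (simp add: override_on_def)
  qed
  finally show ?thesis .
qed

lemma act_ext_op:
  assumes "G \<subseteq> A" "A \<subseteq> {..<n}" "\<forall>i. i \<notin> G \<longrightarrow> e i = d i"
  shows "act n A d e (ext_op G A K) \<psi> = act n G d e K \<psi>"
proof
  fix x
  have fin: "finite A"
    using assms finite_subset by blast
  show "act n A d e (ext_op G A K) \<psi> x = act n G d e K \<psi> x"
  proof (cases "x \<in> labels {..<n} e")
    case True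
    have r: "restrict x A \<in> labels A e"
      using True assms restrict_labels by blast
    have GA: "restrict (restrict x A) G = restrict x G"
      using assms(1) by (simp add: Int_absorb1)
    have "act n A d e (ext_op G A K) \<psi> x
        = (\<Sum>y\<in>labels A d. if \<forall>i\<in>A - G. restrict x A i = y i
             then K (restrict x G) (restrict y G) * \<psi> (override_on x y A) else 0)"
      using True GA unfolding act_def ext_op_def by (auto intro!: sum.cong)
    also have "\<dots> = (\<Sum>w\<in>labels G d. K (restrict x G) (restrict (override_on (restrict x A) w G) G)
        * \<psi> (override_on x (override_on (restrict x A) w G) A))"
      by (rule sum_labels_fixed_outside[OF fin assms(1) r]) (use assms in auto)
    also have "\<dots> = (\<Sum>w\<in>labels G d. K (restrict x G) w * \<psi> (override_on x w G))"
    proof (intro sum.cong refl)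
      fix w assume w: "w \<in> labels G d"
      have "override_on x (override_on (restrict x A) w G) A = override_on x w G"
        using assms(1) by (auto simp: override_on_def fun_eq_iff)
      then show "K (restrict x G) (restrict (override_on (restrict x A) w G) G)
          * \<psi> (override_on x (override_on (restrict x A) w G) A)
          = K (restrict x G) w * \<psi> (override_on x w G)"
        using w by simp
    qed
    also have "\<dots> = act n G d e K \<psi> x"
      using True by (simp add: act_def)
    finally show ?thesis .
  qed (simp add: act_def)
qed

text \<open>The completeness sum factorises: an entry vanishes if its two labels differ on
  \<open>A - G\<close>, and otherwise it is the completeness sum of \<open>K\<close> on
  \<open>G\<close>.\<close>

lemma measurement_ext_op:
  assumes "G \<subseteq> A" "finite A" and M: "measurement G d m e K"
  shows "measurement A d m e (\<lambda>k. ext_op G A (K k))"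
  unfolding measurement_def
proof (intro conjI allI impI ballI)
  fix k i assume "k < m" "i \<notin> A"
  then show "e k i = d i"
    using M assms(1) by (auto simp: measurement_def)
next
  fix x y assume x: "x \<in> labels A d" and y: "y \<in> labels A d"
  have xG: "restrict x G \<in> labels G d" and yG: "restrict y G \<in> labels G d"
    using x y assms restrict_labels by blast+
  show "(\<Sum>k<m. op_comp (labels A (e k)) (adj (ext_op G A (K k))) (ext_op G A (K k)) x y)
      = (if x = y then 1 else 0)"
  proof (cases "\<forall>i\<in>A - G. x i = y i")
    case True
    have "op_comp (labels A (e k)) (adj (ext_op G A (K k))) (ext_op G A (K k)) x y
        = op_comp (labels G (e k)) (adj (K k)) (K k) (restrict x G) (restrict y G)"
      if "k < m" for k
    proof -
      have "op_comp (labels A (e k)) (adj (ext_op G A (K k))) (ext_op G A (K k)) x y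
          = (\<Sum>z\<in>labels A (e k). if \<forall>i\<in>A - G. x i = z i
               then cnj (K k (restrict z G) (restrict x G)) * K k (restrict z G) (restrict y G)
               else 0)"
        using True unfolding op_comp_def adj_def ext_op_def by (auto intro!: sum.cong)
      also have "\<dots> = (\<Sum>w\<in>labels G (e k).
          cnj (K k (restrict (override_on x w G) G) (restrict x G))
            * K k (restrict (override_on x w G) G) (restrict y G))"
        by (rule sum_labels_fixed_outside[OF assms(2,1) x])
          (use M that in \<open>auto simp: measurement_def\<close>)
      also have "\<dots> = op_comp (labels G (e k)) (adj (K k)) (K k) (restrict x G) (restrict y G)"
        unfolding op_comp_def adj_def by (intro sum.cong refl) simp
      finally show ?thesis .
    qed
    then have "(\<Sum>k<m. op_comp (labels A (e k)) (adj (ext_op G A (K k))) (ext_op G A (K k)) x y)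
        = (if restrict x G = restrict y G then 1 else 0)"
      using M xG yG by (simp add: measurement_def)
    moreover have "restrict x G = restrict y G \<longleftrightarrow> x = y"
    proof
      assume eq: "restrict x G = restrict y G"
      show "x = y"
      proof (rule PiE_ext)
        show "x \<in> (\<Pi>\<^sub>E i\<in>A. {..<d i})" "y \<in> (\<Pi>\<^sub>E i\<in>A. {..<d i})"
          using x y by (simp_all add: labels_def)
        show "x i = y i" if "i \<in> A" for i
          using that True eq by (cases "i \<in> G") (auto dest: fun_cong[where x = i])
      qed
    qed simp
    ultimately show ?thesis
      by simp
  next
    case False
    then have "op_comp D (adj (ext_op G A (K k))) (ext_op G A (K k)) x y = 0" for k D
      unfolding op_comp_def adj_def ext_op_def by (intro sum.neutral) auto
    then show ?thesis
      using False by auto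
  qed
qed

text \<open>Identification only asks which vectors vanish, so it survives multiplying states by
  scalars, renaming them through \<open>g\<close>, and enlarging the blocks. This serves both to
  pass from separated parties to a bipartition and to reuse the protocol for \<open>S\<close> on the
  remaining states.\<close>

lemma identifies_transfer:
  assumes "identifies n labs S p d v"
    and "\<forall>G\<in>labs. \<exists>G'\<in>labs'. G \<subseteq> G'" "\<forall>G'\<in>labs'. G' \<subseteq> {..<n}"
    and "\<forall>r\<in>T. \<exists>\<phi>\<in>S. g \<phi> = r \<and> (\<exists>a. v' r = (\<lambda>x. a * v \<phi> x))"
  shows "\<exists>p'. identifies n labs' T p' d v'"
  using assms(1,4)
proof (induction p arbitrary: d v v')
  case (Announce \<phi>)
  \<comment> \<open>A state \<open>r\<close> other than \<open>g \<phi>\<close> comes from some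
    element of \<open>S\<close> other than \<open>\<phi>\<close>, whose current vector is zero;
    injectivity of \<open>g\<close> does not enter.\<close>
  have "identifies n labs' T (Announce (g \<phi>)) d v'"
    using Announce by fastforce
  then show ?case ..
next
  case (Local_Measurement G m e K cont)
  have G: "G \<in> labs" and M: "measurement G d m e K"
    and c: "\<And>k. k < m \<Longrightarrow> identifies n labs S (cont k) (e k) (\<lambda>\<psi>. act n G d (e k) (K k) (v \<psi>))"
    using Local_Measurement.prems(1) by auto
  obtain A where A: "A \<in> labs'" "G \<subseteq> A"
    using assms(2) G by blast
  have An: "A \<subseteq> {..<n}"
    using assms(3) A by blast
  then have fin: "finite A"
    using finite_subset by blast
  have "\<exists>p'. identifies n labs' T p' (e k) (\<lambda>r. act n A d (e k) (ext_op G A (K k)) (v' r))"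
    if k: "k < m" for k
  proof (rule Local_Measurement.IH[OF rangeI c[OF k]], intro ballI)
    fix r assume "r \<in> T"
    then obtain \<phi> a where "\<phi> \<in> S" "g \<phi> = r" "v' r = (\<lambda>x. a * v \<phi> x)"
      using Local_Measurement.prems(2) by blast
    moreover have "act n A d (e k) (ext_op G A (K k)) (v' r) = act n G d (e k) (K k) (v' r)"
      using act_ext_op[OF A(2) An] M k by (auto simp: measurement_def)
    ultimately show "\<exists>\<phi>\<in>S. g \<phi> = r \<and>
        (\<exists>a. act n A d (e k) (ext_op G A (K k)) (v' r) = (\<lambda>x. a * act n G d (e k) (K k) (v \<phi>) x))"
      by (metis act_scale)
  qed
  then obtain c' where "\<And>k. k < m \<Longrightarrow>
      identifies n labs' T (c' k) (e k) (\<lambda>r. act n A d (e k) (ext_op G A (K k)) (v' r))"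
    by metis
  then have "identifies n labs' T (Local_Measurement A m e (\<lambda>k. ext_op G A (K k)) c') d v'"
    using A(1) measurement_ext_op[OF A(2) fin M] by simp
  then show ?case ..
qed

section \<open>Operators on the two sides of a bipartition\<close>

locale bipartite =
  fixes n :: nat and d :: "nat \<Rightarrow> nat" and A B :: "nat set"
  assumes disjoint: "A \<inter> B = {}" and union: "A \<union> B = {..<n}"
begin

lemma subset_A: "A \<subseteq> {..<n}" and subset_B: "B \<subseteq> {..<n}"
  using union by blast+

abbreviation (input) mulA :: "operator \<Rightarrow> operator \<Rightarrow> operator" (infixl "\<cdot>\<^sub>A" 70)
  where "K \<cdot>\<^sub>A L \<equiv> op_comp (labels A d) K L"

abbreviation (input) mulB :: "operator \<Rightarrow> operator \<Rightarrow> operator" (infixl "\<cdot>\<^sub>B" 70)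
  where "K \<cdot>\<^sub>B L \<equiv> op_comp (labels B d) K L"

text \<open>This is \<open>K\<close> \<otimes> \<open>L\<close>, encoded by two commuting local
  actions so that no matrix on the whole space has to be handled.\<close>

definition ten :: "operator \<Rightarrow> operator \<Rightarrow> ket \<Rightarrow> ket" where
  "ten K L \<psi> = act n A d d K (act n B d d L \<psi>)"

lemma ten_in_hilbert [simp]: "ten K L \<psi> \<in> hilbert n d"
  by (simp add: ten_def)

lemma ten_ten: "ten K L (ten K' L' \<psi>) = ten (K \<cdot>\<^sub>A K') (L \<cdot>\<^sub>B L') \<psi>"
  unfolding ten_def
  by (simp add: act_commute[OF subset_B subset_A] disjoint Int_commute act_compose subset_A subset_B)

lemma act_ten: "act n A d d K (ten K' L \<psi>) = ten (K \<cdot>\<^sub>A K') L \<psi>"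
  by (simp add: ten_def act_compose subset_A)

lemma inner_ten_adj:
  "inner_prod n d \<phi> (ten K L \<psi>) = inner_prod n d (ten (adj K) (adj L) \<phi>) \<psi>"
  unfolding ten_def
  by (simp add: inner_act_adj subset_A subset_B act_commute[OF subset_A subset_B disjoint])

lemma ten_cong: "op_eq A d K K' \<Longrightarrow> op_eq B d L L' \<Longrightarrow> ten K L \<psi> = ten K' L' \<psi>"
  unfolding ten_def using act_cong subset_A subset_B by metis

lemma ten_scale: "ten K L (\<lambda>x. a * \<psi> x) = (\<lambda>x. a * ten K L \<psi> x)"
  by (simp add: ten_def act_scale)

lemma ten_sum: "ten K L (\<lambda>x. \<Sum>t\<in>T. c t * v t x) = (\<lambda>x. \<Sum>t\<in>T. c t * ten K L (v t) x)"
  by (simp add: ten_def act_sum)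

lemma ten_zero [simp]: "ten K L (\<lambda>x. 0) = (\<lambda>x. 0)"
  by (simp add: ten_def)

lemma ten_lincomb:
  "ten (\<lambda>x y. a * K x y + b * K' x y) L \<psi> = (\<lambda>x. a * ten K L \<psi> x + b * ten K' L \<psi> x)"
  by (simp add: ten_def act_lincomb)

lemma ten_id: "\<psi> \<in> hilbert n d \<Longrightarrow> ten id_op id_op \<psi> = \<psi>"
  by (simp add: ten_def act_id subset_A subset_B)

text \<open>\<open>override_on x y B\<close> glues a label of \<open>A\<close> to one of
  \<open>B\<close>, so the argument is a product basis vector and its image displays a single
  product of matrix entries.\<close>

lemma ten_entry:
  assumes "x \<in> labels A d" "x' \<in> labels A d" "y \<in> labels B d" "y' \<in> labels B d"
  shows "ten K L (\<lambda>z. if z = override_on x' y' B then 1 else 0) (override_on x y B)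
    = K x x' * L y y'"
proof -
  let ?\<psi> = "\<lambda>z. if z = override_on x' y' B then 1 else 0 :: complex"
  have fin: "finite A" "finite B"
    using subset_A subset_B finite_subset by blast+
  have mem: "override_on a b B \<in> labels {..<n} d" if "a \<in> labels A d" "b \<in> labels B d" for a b
    using that disjoint union unfolding labels_def
    by (auto simp: PiE_iff override_on_def extensional_def)
  have restr: "restrict (override_on a b B) A = a" if "a \<in> labels A d" for a b
    using that disjoint unfolding labels_def
    by (auto simp: PiE_iff override_on_def extensional_def fun_eq_iff)
  have over: "override_on (override_on a b B) a' A = override_on a' b B"
    if "a \<in> labels A d" "a' \<in> labels A d" for a a' b
    using that disjoint unfolding labels_def
    by (auto simp: PiE_iff override_on_def extensional_def fun_eq_iff)
  have eq: "override_on a b B = override_on a' b' B \<longleftrightarrow> a = a' \<and> b = b'"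
    if "a \<in> labels A d" "b \<in> labels B d" "a' \<in> labels A d" "b' \<in> labels B d" for a a' b b'
    by (metis restr restrict_override that)
  have L: "act n B d d L ?\<psi> (override_on a y B) = (if a = x' then L y y' else 0)"
    if a: "a \<in> labels A d" for a
  proof -
    have "act n B d d L ?\<psi> (override_on a y B)
        = (\<Sum>b\<in>labels B d. if b = y' then (if a = x' then L y b else 0) else 0)"
      using a assms mem restrict_override[OF assms(3)] by (auto simp: act_def eq intro!: sum.cong)
    then show ?thesis
      using assms fin by simp
  qed
  have "ten K L ?\<psi> (override_on x y B)
      = (\<Sum>a\<in>labels A d. if a = x' then K x a * L y y' else 0)"
    unfolding ten_def
    using assms mem by (auto simp: act_def[of n A] restr over L intro!: sum.cong)
  then show ?thesis
    using assms fin by simp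
qed

text \<open>One nonzero entry of \<open>L\<close> can be divided out of every matrix entry. This
  brings identities on the whole space down to operators on \<open>A\<close>.\<close>

lemma ten_cancel_right:
  assumes "\<not> op_eq B d L (\<lambda>x y. 0)" "\<And>\<psi>. \<psi> \<in> hilbert n d \<Longrightarrow> ten K L \<psi> = ten K' L \<psi>"
  shows "op_eq A d K K'"
  unfolding op_eq_def
proof (intro ballI)
  fix x x' assume x: "x \<in> labels A d" "x' \<in> labels A d"
  obtain y y' where y: "y \<in> labels B d" "y' \<in> labels B d" "L y y' \<noteq> 0"
    using assms(1) by (auto simp: op_eq_def)
  have "override_on x' y' B \<in> labels {..<n} d"
    using x y disjoint union unfolding labels_def
    by (auto simp: PiE_iff override_on_def extensional_def)
  then have "(\<lambda>z. if z = override_on x' y' B then 1 else 0) \<in> hilbert n d"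
    by (auto simp: hilbert_def)
  from assms(2)[OF this] have "K x x' * L y y' = K' x x' * L y y'"
    using ten_entry[OF x y(1,2)] by metis
  then show "K x x' = K' x x'"
    using y(3) by simp
qed

lemma swap: "bipartite n B A"
  using disjoint union by unfold_locales auto

lemma ten_swap: "bipartite.ten n d B A L K = ten K L"
  by (rule ext)
    (simp add: ten_def bipartite.ten_def[OF swap] act_commute[OF subset_A subset_B disjoint])

lemma act_ten_B: "act n B d d K (ten K' L \<psi>) = ten K' (K \<cdot>\<^sub>B L) \<psi>"
  unfolding ten_swap[symmetric] by (rule bipartite.act_ten[OF swap])

end

section \<open>Partial isometries and their reversal by a measurement\<close>

definition partial_isometry :: "nat set \<Rightarrow> (nat \<Rightarrow> nat) \<Rightarrow> operator \<Rightarrow> bool" where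
  "partial_isometry G d W \<longleftrightarrow>
     op_eq G d (op_comp (labels G d) (op_comp (labels G d) W (adj W)) W) W"

lemma op_comp_id_left: "finite G \<Longrightarrow> op_eq G d (op_comp (labels G d) id_op K) K"
  and op_comp_id_right: "finite G \<Longrightarrow> op_eq G d (op_comp (labels G d) K id_op) K"
proof -
  assume fin: "finite G"
  have "(\<Sum>z\<in>labels G d. id_op x z * K z y) = (\<Sum>z\<in>labels G d. if x = z then K z y else 0)"
    and "(\<Sum>z\<in>labels G d. K x z * id_op z y) = (\<Sum>z\<in>labels G d. if z = y then K x z else 0)"
    for x y
    by (auto simp: id_op_def intro!: sum.cong)
  then show "op_eq G d (op_comp (labels G d) id_op K) K"
    and "op_eq G d (op_comp (labels G d) K id_op) K"
    using fin by (simp_all add: op_eq_def op_comp_def)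
qed

lemma adj_id_op [simp]: "adj id_op = id_op"
  by (auto simp: adj_def id_op_def fun_eq_iff)

lemma partial_isometry_id: "finite G \<Longrightarrow> partial_isometry G d id_op"
  unfolding partial_isometry_def adj_id_op
  by (rule op_eq_trans[OF op_comp_id_right op_comp_id_right])

text \<open>Outcome \<open>0\<close> inverts \<open>W\<close> on its range, and outcome \<open>1\<close> annihilates that range.\<close>

definition undo_op :: "nat set \<Rightarrow> (nat \<Rightarrow> nat) \<Rightarrow> operator \<Rightarrow> nat \<Rightarrow> operator" where
  "undo_op G d W k = (if k = 0 then adj W
     else (\<lambda>x y. 1 * id_op x y + (- 1) * op_comp (labels G d) W (adj W) x y))"

lemma act_undo_op_1:
  assumes "G \<subseteq> {..<n}" "\<psi> \<in> hilbert n d"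
  shows "act n G d d (undo_op G d W 1) \<psi>
    = (\<lambda>x. \<psi> x - act n G d d (op_comp (labels G d) W (adj W)) \<psi> x)"
proof -
  have "act n G d d (undo_op G d W 1) \<psi>
      = (\<lambda>x. 1 * act n G d d id_op \<psi> x + (- 1) * act n G d d (op_comp (labels G d) W (adj W)) \<psi> x)"
    \<comment> \<open>The coefficients 1 and -1 in \<open>undo_op\<close> give it the exact form
      required by \<open>act_lincomb\<close>.\<close>
    unfolding undo_op_def by (simp only: one_neq_zero if_False act_lincomb)
  then show ?thesis
    by (simp add: act_id assms)
qed

text \<open>With E = \<open>W\<close> \<open>adj W\<close>, outcome 0 contributes E to the
  completeness sum. E is a self-adjoint idempotent by the partial isometry equation, so outcome 1
  contributes 1 - E.\<close>

lemma measurement_undo_op: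
  assumes "finite G" "partial_isometry G d W"
  shows "measurement G d 2 (\<lambda>_. d) (undo_op G d W)"
proof -
  let ?D = "labels G d"
  define E where "E = op_comp ?D W (adj W)"
  have fin: "finite ?D"
    using assms(1) by simp
  have "op_eq G d (op_comp ?D E E) E"
  proof -
    have "op_comp ?D E E = op_comp ?D (op_comp ?D E W) (adj W)"
      by (simp add: E_def op_comp_assoc)
    moreover have "op_eq G d (op_comp ?D (op_comp ?D E W) (adj W)) (op_comp ?D W (adj W))"
      using assms(2) by (intro op_eq_comp) (auto simp: partial_isometry_def E_def)
    ultimately show ?thesis
      by (simp add: E_def)
  qed
  then have EE: "(\<Sum>z\<in>?D. E x z * E z y) = E x y" if "x \<in> ?D" "y \<in> ?D" for x y
    using that by (simp add: op_eq_def op_comp_def)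
  have adjE: "cnj (E z x) = E x z" for x z
    using adj_op_comp[of ?D W "adj W"] by (simp add: E_def adj_def fun_eq_iff)
  have undo_1: "undo_op G d W 1 = (\<lambda>x y. id_op x y - E x y)"
    by (simp add: undo_op_def E_def)
  have adj_id: "cnj (id_op z x) = id_op x z" for x z
    by (simp add: id_op_def)
  have "op_comp ?D (adj (undo_op G d W 0)) (undo_op G d W 0) x y
      + op_comp ?D (adj (undo_op G d W 1)) (undo_op G d W 1) x y = id_op x y"
    if x: "x \<in> ?D" and y: "y \<in> ?D" for x y
  proof -
    have "op_comp ?D (adj (undo_op G d W 1)) (undo_op G d W 1) x y
        = (\<Sum>z\<in>?D. (id_op x z - E x z) * (id_op z y - E z y))"
      unfolding undo_1 by (simp add: op_comp_def adj_def adjE adj_id)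
    also have "\<dots> = (\<Sum>z\<in>?D. id_op x z * id_op z y) - (\<Sum>z\<in>?D. id_op x z * E z y)
        - (\<Sum>z\<in>?D. E x z * id_op z y) + (\<Sum>z\<in>?D. E x z * E z y)"
      by (simp add: algebra_simps sum.distrib sum_subtractf)
    also have "\<dots> = id_op x y - E x y"
      using op_comp_id_left[OF assms(1), of d] op_comp_id_right[OF assms(1), of d] x y EE[OF x y]
      by (simp add: op_eq_def op_comp_def)
    finally show ?thesis
      by (simp add: undo_op_def E_def)
  qed
  then show ?thesis
    unfolding measurement_def by (simp add: numeral_2_eq_2 id_op_def)
qed

section \<open>Operators diagonal in an orthonormal basis\<close>

text \<open>Lagrange interpolation at the finitely many values of \<open>c\<close>. The class
  \<open>\<G>\<close> need not contain the constant functions, so only polynomials in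
  \<open>c\<close> without constant term are available; this is the reason for
  \<open>f 0 = 0\<close>.\<close>

lemma functional_calculus:
  fixes c :: "'s \<Rightarrow> complex" and f :: "complex \<Rightarrow> complex"
  assumes "finite S"
    and c: "\<G> c" and add: "\<And>g h. \<G> g \<Longrightarrow> \<G> h \<Longrightarrow> \<G> (\<lambda>s. g s + h s)"
    and mult: "\<And>g h. \<G> g \<Longrightarrow> \<G> h \<Longrightarrow> \<G> (\<lambda>s. g s * h s)"
    and scale: "\<And>a g. \<G> g \<Longrightarrow> \<G> (\<lambda>s. a * g s)"
    and cong: "\<And>g h. \<G> g \<Longrightarrow> (\<And>s. s \<in> S \<Longrightarrow> g s = h s) \<Longrightarrow> \<G> h"
    and "f 0 = 0"
  shows "\<G> (\<lambda>s. f (c s))"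
proof -
  have zero: "\<G> (\<lambda>s. 0)"
    using scale[OF c, of 0] by simp
  \<comment> \<open>The leading factor \<open>c s\<close> removes the constant term.\<close>
  have lagrange: "\<G> (\<lambda>s. c s * (\<Prod>t\<in>E. c s - t))" if "finite E" for E
    using that
  proof induction
    case (insert t E)
    let ?g = "\<lambda>s. c s * (\<Prod>t\<in>E. c s - t)"
    have "\<G> (\<lambda>s. c s * ?g s + (- t) * ?g s)"
      by (intro add mult scale c insert.IH)
    then show ?case
      by (rule cong) (use insert.hyps in \<open>simp add: algebra_simps\<close>)
  qed (simp add: c)
  \<comment> \<open>For \<open>t = 0\<close> the function is zero because \<open>f 0 = 0\<close>.
    For other \<open>t\<close> the interpolation polynomial is divided by its value at
    \<open>t\<close>, which is nonzero.\<close>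
  have indicator: "\<G> (\<lambda>s. if c s = t then f t else 0)" if "t \<in> c ` S" for t
  proof (cases "t = 0")
    case True
    show ?thesis
      using zero by (rule cong) (simp add: True \<open>f 0 = 0\<close>)
  next
    case False
    let ?E = "c ` S - {t}"
    have fin: "finite ?E"
      using assms(1) by simp
    have nz: "t * (\<Prod>u\<in>?E. t - u) \<noteq> 0"
      using False fin by auto
    show ?thesis
      using scale[OF lagrange[OF fin], of "f t / (t * (\<Prod>u\<in>?E. t - u))"]
    proof (rule cong)
      fix s assume s: "s \<in> S"
      show "f t / (t * (\<Prod>u\<in>?E. t - u)) * (c s * (\<Prod>u\<in>?E. c s - u))
          = (if c s = t then f t else 0)"
      proof (cases "c s = t")
        case True
        then show ?thesis
          using nz by simp
      next
        case False
        then have "(\<Prod>u\<in>?E. c s - u) = 0"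
          using s fin by auto
        then show ?thesis
          using False by simp
      qed
    qed
  qed
  have "\<G> (\<lambda>s. \<Sum>t\<in>E. if c s = t then f t else 0)" if "finite E" "E \<subseteq> c ` S" for E
    using that
  proof induction
    case (insert t E)
    then have "\<G> (\<lambda>s. (if c s = t then f t else 0) + (\<Sum>t\<in>E. if c s = t then f t else 0))"
      by (intro add indicator) auto
    then show ?case
      by (rule cong) (use insert.hyps in simp)
  qed (simp add: zero)
  from this[of "c ` S"] have "\<G> (\<lambda>s. \<Sum>t\<in>c ` S. if c s = t then f t else 0)"
    using \<open>finite S\<close> by simp
  then show ?thesis
    by (rule cong) (use \<open>finite S\<close> in auto)
qed

locale bipartite_basis = bipartite +
  fixes S :: "ket set"
  assumes finite_basis: "finite S" and orthonormal_basis: "orthonormal n d S"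
    and complete: "\<psi> \<in> hilbert n d \<Longrightarrow> \<exists>c. \<psi> = (\<lambda>x. \<Sum>\<phi>\<in>S. c \<phi> * \<phi> x)"
begin

lemma basis_in_hilbert: "\<phi> \<in> S \<Longrightarrow> \<phi> \<in> hilbert n d"
  using orthonormal_basis by (auto simp: orthonormal_def)

lemma inner_basis: "\<phi> \<in> S \<Longrightarrow> \<psi> \<in> S \<Longrightarrow> inner_prod n d \<phi> \<psi> = (if \<phi> = \<psi> then 1 else 0)"
  using orthonormal_basis by (auto simp: orthonormal_def)

lemma basis_expansion:
  assumes "\<psi> \<in> hilbert n d"
  shows "\<psi> = (\<lambda>x. \<Sum>\<phi>\<in>S. inner_prod n d \<phi> \<psi> * \<phi> x)"
proof -
  obtain c where c: "\<psi> = (\<lambda>x. \<Sum>\<phi>\<in>S. c \<phi> * \<phi> x)"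
    using complete assms by blast
  have "inner_prod n d \<phi> \<psi> = c \<phi>" if "\<phi> \<in> S" for \<phi>
    using that finite_basis
    by (subst c) (simp add: inner_sum_right inner_basis if_distrib cong: if_cong)
  then show ?thesis
    by (subst c) (simp cong: sum.cong)
qed

lemma ten_eq_on_basis:
  assumes "\<And>\<phi>. \<phi> \<in> S \<Longrightarrow> ten K L \<phi> = ten K' L' \<phi>" "\<psi> \<in> hilbert n d"
  shows "ten K L \<psi> = ten K' L' \<psi>"
  by (subst (1 2) basis_expansion[OF assms(2)]) (simp add: ten_sum assms(1) cong: sum.cong)

lemma diagonal:
  assumes "\<psi> \<in> S" "\<And>\<phi>. \<phi> \<in> S \<Longrightarrow> \<phi> \<noteq> \<psi> \<Longrightarrow> inner_prod n d \<phi> (ten K L \<psi>) = 0"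
  shows "ten K L \<psi> = (\<lambda>x. inner_prod n d \<psi> (ten K L \<psi>) * \<psi> x)"
proof
  fix x
  have "ten K L \<psi> x = (\<Sum>\<phi>\<in>S. inner_prod n d \<phi> (ten K L \<psi>) * \<phi> x)"
    by (subst basis_expansion[OF ten_in_hilbert]) simp
  also have "\<dots> = (\<Sum>\<phi>\<in>S. if \<phi> = \<psi> then inner_prod n d \<psi> (ten K L \<psi>) * \<psi> x else 0)"
    using assms(2) by (intro sum.cong) auto
  finally show "ten K L \<psi> x = inner_prod n d \<psi> (ten K L \<psi>) * \<psi> x"
    using assms(1) finite_basis by simp
qed

lemma diagonal_adj:
  assumes "\<And>\<phi>. \<phi> \<in> S \<Longrightarrow> ten K L \<phi> = (\<lambda>x. g \<phi> * \<phi> x)" "\<psi> \<in> S"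
  shows "ten (adj K) (adj L) \<psi> = (\<lambda>x. cnj (g \<psi>) * \<psi> x)"
proof -
  have *: "inner_prod n d \<phi> (ten (adj K) (adj L) \<psi>) = cnj (g \<phi>) * inner_prod n d \<phi> \<psi>"
    if "\<phi> \<in> S" for \<phi>
    using that by (simp add: inner_ten_adj assms(1) inner_scale_left)
  show ?thesis
    using diagonal[OF assms(2), of "adj K" "adj L"] assms(2) by (simp add: * inner_basis)
qed

section \<open>States remaining after a protocol\<close>

text \<open>The invariant of a protocol. \<open>W\<close> and \<open>V\<close> need not be the
  accumulated projections; they only have to yield the same normalised states. Orthogonality is
  indexed by \<open>S\<close> rather than \<open>R\<close>, the form in which
  \<open>diagonal\<close> uses it.\<close>

definition reachable :: "ket set \<Rightarrow> bool" where
  "reachable R \<longleftrightarrow> (\<exists>W V. partial_isometry A d W \<and> partial_isometry B d V \<and>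
     (\<forall>\<phi>\<in>S. \<forall>\<psi>\<in>S. \<phi> \<noteq> \<psi> \<longrightarrow> inner_prod n d (ten W V \<phi>) (ten W V \<psi>) = 0) \<and>
     R = normalized_image n d (ten W V) S)"

lemma reachable_start: "reachable S"
  unfolding reachable_def
proof (intro exI conjI ballI impI)
  show "partial_isometry A d id_op" "partial_isometry B d id_op"
    using subset_A subset_B finite_subset by (auto intro!: partial_isometry_id)
  have id: "ten id_op id_op \<phi> = \<phi>" if "\<phi> \<in> S" for \<phi>
    using ten_id basis_in_hilbert that by blast
  show "inner_prod n d (ten id_op id_op \<phi>) (ten id_op id_op \<psi>) = 0"
    if "\<phi> \<in> S" "\<psi> \<in> S" "\<phi> \<noteq> \<psi>" for \<phi> \<psi>
    using that by (simp add: id inner_basis)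
  have "normalize_ket n d \<phi> = \<phi>" "\<phi> \<noteq> (\<lambda>_. 0)" if "\<phi> \<in> S" for \<phi>
    using inner_basis[OF that that] by (auto simp: normalize_ket_def)
  then show "S = normalized_image n d (ten id_op id_op) S"
    unfolding normalized_image_def using id by (force simp: image_iff)
qed

lemma partial_isometry_cancel:
  assumes "partial_isometry B d V"
  shows "op_eq B d (V \<cdot>\<^sub>B (adj V \<cdot>\<^sub>B V)) V"
  using assms by (simp add: partial_isometry_def op_comp_assoc)

text \<open>
  Polar decomposition of \<open>K\<close> relative to the basis: \<open>M = K\<^sup>* K\<close> tensored with the support
  projector \<open>Q\<close> of \<open>V\<close> is diagonal, so \<open>X = M^(-1/2)\<close> (on the support of \<open>M\<close>) is obtained
  by Lagrange interpolation on its eigenvalues.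
\<close>

lemma polar_decomposition:
  assumes V: "partial_isometry B d V" and V0: "\<not> op_eq B d V (\<lambda>x y. 0)"
    and orth: "\<And>\<phi> \<psi>. \<phi> \<in> S \<Longrightarrow> \<psi> \<in> S \<Longrightarrow> \<phi> \<noteq> \<psi> \<Longrightarrow>
      inner_prod n d (ten K V \<phi>) (ten K V \<psi>) = 0"
  obtains W where "partial_isometry A d W"
    and "\<And>\<phi>. \<phi> \<in> S \<Longrightarrow> ten K V \<phi> \<noteq> (\<lambda>_. 0) \<Longrightarrow>
      \<exists>a>0. ten W V \<phi> = (\<lambda>x. of_real a * ten K V \<phi> x)"
    and "\<And>\<phi>. \<phi> \<in> S \<Longrightarrow> ten K V \<phi> = (\<lambda>_. 0) \<Longrightarrow> ten W V \<phi> = (\<lambda>_. 0)"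
proof -
  define M where "M = adj K \<cdot>\<^sub>A K"
  define Q where "Q = adj V \<cdot>\<^sub>B V"
  define c where "c \<phi> = inner_prod n d (ten K V \<phi>) (ten K V \<phi>)" for \<phi>
  have VQ: "op_eq B d (V \<cdot>\<^sub>B Q) V"
    unfolding Q_def by (rule partial_isometry_cancel[OF V])
  have QQ: "op_eq B d (Q \<cdot>\<^sub>B Q) Q"
    unfolding Q_def op_comp_assoc
    using op_eq_comp[OF op_eq_refl VQ, of "adj V"] by (simp add: Q_def)
  \<comment> \<open>The four copies of \<open>Q\<close> will accompany the factors \<open>X\<close>,
    \<open>adj X\<close>, \<open>M\<close> and \<open>X\<close> when the partial isometry equation
    for \<open>W\<close> is verified.\<close>
  have "op_eq B d (Q \<cdot>\<^sub>B (Q \<cdot>\<^sub>B (Q \<cdot>\<^sub>B Q))) Q"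
    by (rule op_eq_trans[OF op_eq_comp[OF op_eq_refl
          op_eq_trans[OF op_eq_comp[OF op_eq_refl QQ] QQ]] QQ])
  then have VQQQQ: "op_eq B d (V \<cdot>\<^sub>B (Q \<cdot>\<^sub>B (Q \<cdot>\<^sub>B (Q \<cdot>\<^sub>B Q)))) V"
    by (rule op_eq_trans[OF op_eq_comp[OF op_eq_refl] VQ])
  have adjQ: "adj Q = Q"
    by (simp add: Q_def adj_op_comp)
  have MQ_inner: "inner_prod n d \<phi> (ten M Q \<psi>) = inner_prod n d (ten K V \<phi>) (ten K V \<psi>)" for \<phi> \<psi>
    unfolding M_def Q_def ten_ten[symmetric] by (simp add: inner_ten_adj)
  have MQ: "ten M Q \<psi> = (\<lambda>x. c \<psi> * \<psi> x)" if "\<psi> \<in> S" for \<psi>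
    using diagonal[OF that, of M Q] that by (simp add: MQ_inner orth c_def)
  \<comment> \<open>The inverse square root, extended by 0 at 0. The real part is harmless, since
    the eigenvalues \<open>c \<phi>\<close> are squared norms.\<close>
  define f :: "complex \<Rightarrow> complex"
    where "f t = (if t = 0 then 0 else of_real (1 / sqrt (Re t)))" for t
  \<comment> \<open>\<open>\<G> g\<close> says that the operator with eigenvalues \<open>g\<close>
    on \<open>S\<close> is of the form X \<otimes> \<open>Q\<close> with this fixed second
    factor.\<close>
  define \<G> where "\<G> g \<longleftrightarrow> (\<exists>X. \<forall>\<phi>\<in>S. ten X Q \<phi> = (\<lambda>x. g \<phi> * \<phi> x))" for g :: "ket \<Rightarrow> complex"
  have "\<G> (\<lambda>\<phi>. f (c \<phi>))"
  proof (rule functional_calculus[where \<G> = \<G> and c = c and f = f, OF finite_basis])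
    show "\<G> c"
      unfolding \<G>_def using MQ by (intro exI[of _ M] ballI)
    show "f 0 = 0"
      by (simp add: f_def)
  next
    fix g h :: "ket \<Rightarrow> complex" assume "\<G> g" "\<G> h"
    then obtain X Y where X: "\<forall>\<phi>\<in>S. ten X Q \<phi> = (\<lambda>x. g \<phi> * \<phi> x)"
      and Y: "\<forall>\<phi>\<in>S. ten Y Q \<phi> = (\<lambda>x. h \<phi> * \<phi> x)"
      unfolding \<G>_def by (elim exE)
    have "ten (\<lambda>x y. 1 * X x y + 1 * Y x y) Q \<phi> = (\<lambda>x. (g \<phi> + h \<phi>) * \<phi> x)" if "\<phi> \<in> S" for \<phi>
      unfolding ten_lincomb using X Y that by (simp add: distrib_right)
    then show "\<G> (\<lambda>s. g s + h s)"
      unfolding \<G>_def by (intro exI ballI)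
    have "ten (X \<cdot>\<^sub>A Y) Q \<phi> = (\<lambda>x. (g \<phi> * h \<phi>) * \<phi> x)" if "\<phi> \<in> S" for \<phi>
    proof -
      \<comment> \<open>Idempotence of \<open>Q\<close> restores the second factor after
        multiplication.\<close>
      have "ten (X \<cdot>\<^sub>A Y) Q \<phi> = ten X Q (ten Y Q \<phi>)"
        unfolding ten_ten by (rule ten_cong[OF op_eq_refl op_eq_sym[OF QQ]])
      then show ?thesis
        using X Y that by (simp add: ten_scale) (simp add: mult_ac)
    qed
    then show "\<G> (\<lambda>s. g s * h s)"
      unfolding \<G>_def by (intro exI ballI)
  next
    fix a and g :: "ket \<Rightarrow> complex" assume "\<G> g"
    then obtain X where X: "\<forall>\<phi>\<in>S. ten X Q \<phi> = (\<lambda>x. g \<phi> * \<phi> x)"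
      unfolding \<G>_def by (elim exE)
    have "ten (\<lambda>x y. a * X x y + 0 * X x y) Q \<phi> = (\<lambda>x. (a * g \<phi>) * \<phi> x)" if "\<phi> \<in> S" for \<phi>
      unfolding ten_lincomb using X that by (simp add: mult.assoc)
    then show "\<G> (\<lambda>s. a * g s)"
      unfolding \<G>_def by (intro exI ballI)
  next
    fix g h :: "ket \<Rightarrow> complex" assume "\<G> g" "\<And>s. s \<in> S \<Longrightarrow> g s = h s"
    then show "\<G> h"
      by (simp add: \<G>_def)
  qed
  then obtain X where X: "\<And>\<phi>. \<phi> \<in> S \<Longrightarrow> ten X Q \<phi> = (\<lambda>x. f (c \<phi>) * \<phi> x)"
    unfolding \<G>_def by (elim exE) blast
  have cnj_f: "cnj (f t) = f t" for t
    by (simp add: f_def)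
  \<comment> \<open>\<open>X\<close> comes from an existence statement, so its self-adjointness is
    not at hand; the eigenvalues being real gives \<open>adj X\<close> the same action.\<close>
  have X': "ten (adj X) Q \<phi> = (\<lambda>x. f (c \<phi>) * \<phi> x)" if "\<phi> \<in> S" for \<phi>
    using diagonal_adj[OF X that] by (simp add: adjQ cnj_f)
  \<comment> \<open>The scalar form of the partial isometry equation for \<open>W\<close>.\<close>
  have fcf: "f (c \<phi>) * c \<phi> * f (c \<phi>) * f (c \<phi>) = f (c \<phi>)" for \<phi>
  proof (cases "c \<phi> = 0")
    case False
    define r where "r = Re (c \<phi>)"
    have r: "c \<phi> = of_real r" "0 \<le> r"
      unfolding c_def r_def by (rule inner_self_real, rule inner_self_nonneg)
    then have "0 < r"
      using False by (auto simp: less_le)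
    then have "sqrt r * sqrt r = r" "sqrt r \<noteq> 0"
      by simp_all
    then have "1 / sqrt r * r * (1 / sqrt r) * (1 / sqrt r) = 1 / sqrt r"
      by (simp add: field_simps)
    then have "of_real (1 / sqrt r * r * (1 / sqrt r) * (1 / sqrt r)) = (of_real (1 / sqrt r) :: complex)"
      by (rule arg_cong)
    then show ?thesis
      using False r by (simp only: f_def if_False Re_complex_of_real of_real_mult)
  qed (simp add: f_def)
  define W where "W = K \<cdot>\<^sub>A X"
  have WV: "ten W V \<phi> = (\<lambda>x. f (c \<phi>) * ten K V \<phi> x)" if "\<phi> \<in> S" for \<phi>
  proof -
    have "ten W V \<phi> = ten K V (ten X Q \<phi>)"
      unfolding ten_ten W_def by (rule ten_cong[OF op_eq_refl op_eq_sym[OF VQ]])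
    then show ?thesis
      by (simp add: X that ten_scale)
  qed
  show ?thesis
  proof
    let ?L = "W \<cdot>\<^sub>A adj W \<cdot>\<^sub>A W"
    have L: "ten ?L V \<phi> = ten W V \<phi>" if "\<phi> \<in> S" for \<phi>
    proof -
      have "ten ?L V \<phi> = ten (K \<cdot>\<^sub>A (X \<cdot>\<^sub>A (adj X \<cdot>\<^sub>A (M \<cdot>\<^sub>A X)))) V \<phi>"
        by (simp add: W_def M_def adj_op_comp op_comp_assoc)
      also have "\<dots> = ten (K \<cdot>\<^sub>A (X \<cdot>\<^sub>A (adj X \<cdot>\<^sub>A (M \<cdot>\<^sub>A X)))) (V \<cdot>\<^sub>B (Q \<cdot>\<^sub>B (Q \<cdot>\<^sub>B (Q \<cdot>\<^sub>B Q)))) \<phi>"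
        by (rule ten_cong[OF op_eq_refl op_eq_sym[OF VQQQQ]])
      also have "\<dots> = ten K V (ten X Q (ten (adj X) Q (ten M Q (ten X Q \<phi>))))"
        by (simp add: ten_ten)
      also have "\<dots> = (\<lambda>x. (f (c \<phi>) * c \<phi> * f (c \<phi>) * f (c \<phi>)) * ten K V \<phi> x)"
        using that by (simp add: X X' MQ ten_scale mult.assoc)
      finally show ?thesis
        by (simp add: fcf WV that)
    qed
    show "partial_isometry A d W"
      unfolding partial_isometry_def
      \<comment> \<open>Equality on the basis extends to the whole space, and the nonzero factor
        \<open>V\<close> is then cancelled.\<close>
      by (rule ten_cancel_right[OF V0], rule ten_eq_on_basis[OF L])
  next
    fix \<phi> assume \<phi>: "\<phi> \<in> S" "ten K V \<phi> \<noteq> (\<lambda>_. 0)"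
    then have pos: "0 < Re (c \<phi>)"
      unfolding c_def by (intro inner_self_pos ten_in_hilbert)
    then have "f (c \<phi>) = of_real (1 / sqrt (Re (c \<phi>)))"
      by (auto simp: f_def)
    then have "ten W V \<phi> = (\<lambda>x. of_real (1 / sqrt (Re (c \<phi>))) * ten K V \<phi> x)"
      using WV[OF \<phi>(1)] by simp
    moreover have "0 < 1 / sqrt (Re (c \<phi>))"
      using pos by simp
    ultimately show "\<exists>a>0. ten W V \<phi> = (\<lambda>x. of_real a * ten K V \<phi> x)"
      by blast
  next
    fix \<phi> assume "\<phi> \<in> S" "ten K V \<phi> = (\<lambda>_. 0)"
    then show "ten W V \<phi> = (\<lambda>_. 0)"
      by (simp add: WV)
  qed
qed

text \<open>\<open>P\<close> spoils the partial isometry on A, and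
  \<open>polar_decomposition\<close> repairs it at the cost of positive factors, which normalisation
  removes.\<close>

lemma reachable_step:
  assumes R: "reachable R"
    and orth: "\<forall>\<phi>\<in>R. \<forall>\<psi>\<in>R. \<phi> \<noteq> \<psi> \<longrightarrow>
      inner_prod n d (act n A d d P \<phi>) (act n A d d P \<psi>) = 0"
  shows "reachable (post_states n d A P R)"
proof -
  obtain W V where W: "partial_isometry A d W" and V: "partial_isometry B d V"
    and WV: "\<And>\<phi> \<psi>. \<phi> \<in> S \<Longrightarrow> \<psi> \<in> S \<Longrightarrow> \<phi> \<noteq> \<psi> \<Longrightarrow> inner_prod n d (ten W V \<phi>) (ten W V \<psi>) = 0"
    and R_eq: "R = normalized_image n d (ten W V) S"
    using R unfolding reachable_def by blast
  let ?K = "P \<cdot>\<^sub>A W"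
  have post: "post_states n d A P R = normalized_image n d (ten ?K V) S"
    unfolding R_eq by (simp add: post_states_normalized_image act_ten)
  have orthK: "inner_prod n d (ten ?K V \<phi>) (ten ?K V \<psi>) = 0"
    if "\<phi> \<in> S" "\<psi> \<in> S" "\<phi> \<noteq> \<psi>" for \<phi> \<psi>
  proof (cases "ten W V \<phi> = (\<lambda>_. 0) \<or> ten W V \<psi> = (\<lambda>_. 0)")
    case True
    then show ?thesis
      by (auto simp flip: act_ten)
  next
    case False
    obtain a b where ab: "0 < a" "normalize_ket n d (ten W V \<phi>) = (\<lambda>x. of_real a * ten W V \<phi> x)"
      "0 < b" "normalize_ket n d (ten W V \<psi>) = (\<lambda>x. of_real b * ten W V \<psi> x)"
      using False by (metis normalize_ket_eq_scale ten_in_hilbert)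
    let ?r = "\<lambda>x. of_real a * ten W V \<phi> x" and ?s = "\<lambda>x. of_real b * ten W V \<psi> x"
    have "?r \<in> R" "?s \<in> R"
      using False that unfolding R_eq normalized_image_def ab(2,4)[symmetric] by blast+
    \<comment> \<open>The hypothesis speaks about distinct members of the set \<open>R\<close>, so
      it must be excluded that two basis elements yield the same remaining state: a nonzero vector
      is not orthogonal to itself.\<close>
    moreover have "?r \<noteq> ?s"
    proof
      assume eq: "?r = ?s"
      have "inner_prod n d ?r ?s = 0"
        using WV[OF that] by (simp add: inner_scale_left inner_scale_right)
      then have "inner_prod n d ?r ?r = 0"
        using eq by simp
      then have "inner_prod n d (ten W V \<phi>) (ten W V \<phi>) = 0"
        using ab(1) by (simp add: inner_scale_left inner_scale_right)
      then show False
        using inner_self_pos[OF ten_in_hilbert, of W V \<phi>] False by simp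
    qed
    ultimately have "inner_prod n d (act n A d d P ?r) (act n A d d P ?s) = 0"
      using orth by blast
    then show ?thesis
      using ab by (simp add: act_scale inner_scale_left inner_scale_right flip: act_ten)
  qed
  show ?thesis
  \<comment> \<open>A vanishing \<open>V\<close> cannot be cancelled, but then no state remains and
    the old \<open>W\<close> and \<open>V\<close> still serve.\<close>
  proof (cases "op_eq B d V (\<lambda>x y. 0)")
    case True
    have zero: "ten L V \<phi> = (\<lambda>_. 0)" for L \<phi>
      by (simp add: ten_cong[OF op_eq_refl True]) (simp add: ten_def act_def cong: if_cong)
    then show ?thesis
      unfolding reachable_def using W V post
      by (intro exI[of _ W] exI[of _ V]) (simp add: zero normalized_image_def)
  next
    case False
    obtain W' where W': "partial_isometry A d W'"
      and pos: "\<And>\<phi>. \<phi> \<in> S \<Longrightarrow> ten ?K V \<phi> \<noteq> (\<lambda>_. 0) \<Longrightarrow>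
        \<exists>a>0. ten W' V \<phi> = (\<lambda>x. of_real a * ten ?K V \<phi> x)"
      and zero: "\<And>\<phi>. \<phi> \<in> S \<Longrightarrow> ten ?K V \<phi> = (\<lambda>_. 0) \<Longrightarrow> ten W' V \<phi> = (\<lambda>_. 0)"
      using polar_decomposition[OF V False orthK] by blast
    have scaled: "\<exists>a. ten W' V \<phi> = (\<lambda>x. a * ten ?K V \<phi> x)" if "\<phi> \<in> S" for \<phi>
      using pos[OF that] zero[OF that] by (cases "ten ?K V \<phi> = (\<lambda>_. 0)") auto
    have "inner_prod n d (ten W' V \<phi>) (ten W' V \<psi>) = 0"
      if "\<phi> \<in> S" "\<psi> \<in> S" "\<phi> \<noteq> \<psi>" for \<phi> \<psi>
      using scaled[OF that(1)] scaled[OF that(2)] orthK[OF that]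
      by (auto simp: inner_scale_left inner_scale_right)
    moreover have "post_states n d A P R = normalized_image n d (ten W' V) S"
      unfolding post by (rule sym, rule normalized_image_cong_scale) (use pos zero in auto)
    ultimately show ?thesis
      unfolding reachable_def using W' V by blast
  qed
qed

lemma swap_basis: "bipartite_basis n d B A S"
  using swap finite_basis orthonormal_basis complete
  by (simp add: bipartite_basis_def bipartite_basis_axioms_def)

text \<open>\<open>ten\<close> is symmetric in the two sides, so the step proved for measurements of
  \<open>A\<close> also covers those of \<open>B\<close>.\<close>

lemma reachable_swap: "bipartite_basis.reachable n d B A S R \<longleftrightarrow> reachable R"
  unfolding reachable_def bipartite_basis.reachable_def[OF swap_basis] ten_swap by blast

lemma reachable_remaining:
  assumes "reachable R" "op_lpcc_protocol n d {A, B} p R" "T \<in> remaining_sets n d p R"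
  shows "reachable T"
  using assms
proof (induction p arbitrary: R)
  case (Project G m P cont)
  then obtain k where k: "k < m" "T \<in> remaining_sets n d (cont k) (post_states n d G (P k) R)"
    by auto
  have orth: "\<forall>\<phi>\<in>R. \<forall>\<psi>\<in>R. \<phi> \<noteq> \<psi> \<longrightarrow>
      inner_prod n d (act n G d d (P k) \<phi>) (act n G d d (P k) \<psi>) = 0"
    using Project.prems(2) k(1) by (simp add: orthogonality_preserving_def)
  have "G = A \<or> G = B"
    using Project.prems(2) by simp
  then have "reachable (post_states n d G (P k) R)"
    using reachable_step bipartite_basis.reachable_step[OF swap_basis] reachable_swap
      Project.prems(1) orth by metis
  then show ?case
    using Project.IH[of "cont k"] Project.prems(2) k by auto
qed simp

text \<open>The undoing measurements on both sides succeed with certainty and return each remaining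
  state to a multiple of its basis element; the protocol for \<open>S\<close> then takes
  over.\<close>

lemma distinguishable_reachable:
  assumes "reachable R" "locally_distinguishable n d {A, B} S"
  shows "locally_distinguishable n d {A, B} R"
proof -
  obtain W V where W: "partial_isometry A d W" and V: "partial_isometry B d V"
    and orth: "\<And>\<phi> \<psi>. \<phi> \<in> S \<Longrightarrow> \<psi> \<in> S \<Longrightarrow> \<phi> \<noteq> \<psi> \<Longrightarrow> inner_prod n d (ten W V \<phi>) (ten W V \<psi>) = 0"
    and R_eq: "R = normalized_image n d (ten W V) S"
    using assms(1) unfolding reachable_def by blast
  have fin: "finite A" "finite B"
    using subset_A subset_B finite_subset by blast+
  define vA where "vA k r = act n A d d (undo_op A d W k) r" for k r
  define v where "v r = act n B d d (adj V) (act n A d d (adj W) r)" for r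
  have R_rep: "\<exists>\<phi>\<in>S. normalize_ket n d (ten W V \<phi>) = r \<and> (\<exists>a. r = (\<lambda>x. a * ten W V \<phi> x))"
    if "r \<in> R" for r
    using that unfolding R_eq normalized_image_def
    by (auto) (metis normalize_ket_eq_scale ten_in_hilbert)
  \<comment> \<open>Remaining states lie in the range of \<open>W\<close> on the A side, where the
    failure operator vanishes.\<close>
  have W_fail: "vA 1 r = (\<lambda>_. 0)" if r_in: "r \<in> R" for r
  proof -
    obtain \<phi> a where r: "r = (\<lambda>x. a * ten W V \<phi> x)"
      using R_rep[OF r_in] by blast
    have "act n A d d (undo_op A d W 1) (ten W V \<phi>) = (\<lambda>x. ten W V \<phi> x - ten (W \<cdot>\<^sub>A adj W \<cdot>\<^sub>A W) V \<phi> x)"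
      unfolding act_undo_op_1[OF subset_A ten_in_hilbert] by (simp only: act_ten)
    also have "\<dots> = (\<lambda>_. 0)"
      using ten_cong[OF W[unfolded partial_isometry_def] op_eq_refl, of V \<phi>] by simp
    finally show ?thesis
      by (simp add: vA_def r act_scale)
  qed
  have V_fail: "act n B d d (undo_op B d V 1) (vA 0 r) = (\<lambda>_. 0)" if r_in: "r \<in> R" for r
  proof -
    obtain \<phi> a where r: "r = (\<lambda>x. a * ten W V \<phi> x)"
      using R_rep[OF r_in] by blast
    have vA0: "vA 0 r = (\<lambda>x. a * ten (adj W \<cdot>\<^sub>A W) V \<phi> x)"
      by (simp add: vA_def undo_op_def r act_scale act_ten)
    have "act n B d d (undo_op B d V 1) (ten (adj W \<cdot>\<^sub>A W) V \<phi>)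
        = (\<lambda>x. ten (adj W \<cdot>\<^sub>A W) V \<phi> x - ten (adj W \<cdot>\<^sub>A W) (V \<cdot>\<^sub>B adj V \<cdot>\<^sub>B V) \<phi> x)"
      unfolding act_undo_op_1[OF subset_B ten_in_hilbert] by (simp only: act_ten_B)
    also have "\<dots> = (\<lambda>_. 0)"
      using ten_cong[OF op_eq_refl V[unfolded partial_isometry_def], of "adj W \<cdot>\<^sub>A W" \<phi>] by simp
    finally show ?thesis
      by (simp add: vA0 act_scale)
  qed
  \<comment> \<open>The operator undoing both sides has matrix elements equal to inner products of
    the images under \<open>W\<close> \<otimes> \<open>V\<close>, so \<open>diagonal\<close>
    applies.\<close>
  have v: "\<exists>a. v r = (\<lambda>x. a * \<phi> x)"
    if \<phi>: "\<phi> \<in> S" and r: "r = (\<lambda>x. b * ten W V \<phi> x)" for r \<phi> b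
  proof -
    have "v (ten W V \<phi>) = ten (adj W \<cdot>\<^sub>A W) (adj V \<cdot>\<^sub>B V) \<phi>"
      unfolding v_def by (simp add: act_ten act_ten_B)
    moreover have "inner_prod n d \<psi> (ten (adj W \<cdot>\<^sub>A W) (adj V \<cdot>\<^sub>B V) \<phi>)
        = inner_prod n d (ten W V \<psi>) (ten W V \<phi>)" for \<psi>
      unfolding ten_ten[symmetric] by (simp add: inner_ten_adj)
    ultimately obtain c where "v (ten W V \<phi>) = (\<lambda>x. c * \<phi> x)"
      using diagonal[OF \<phi>, of "adj W \<cdot>\<^sub>A W" "adj V \<cdot>\<^sub>B V"] orth \<phi> by auto
    then have "v r = (\<lambda>x. (b * c) * \<phi> x)"
      by (simp add: r v_def act_scale mult.assoc)
    then show ?thesis ..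
  qed
  obtain p where "identifies n {A, B} S p d (\<lambda>\<psi>. \<psi>)"
    using assms(2) unfolding locally_distinguishable_def by blast
  then have "\<exists>p'. identifies n {A, B} R p' d v"
  proof (rule identifies_transfer[where g = "\<lambda>\<phi>. normalize_ket n d (ten W V \<phi>)"])
    show "\<forall>r\<in>R. \<exists>\<phi>\<in>S. normalize_ket n d (ten W V \<phi>) = r \<and> (\<exists>a. v r = (\<lambda>x. a * \<phi> x))"
      using R_rep v by metis
  qed (use subset_A subset_B in auto)
  then obtain p' where p': "identifies n {A, B} R p' d v" ..
  \<comment> \<open>The announced vector is arbitrary, since the failure branches have probability
    zero.\<close>
  let ?fail = "Announce (\<lambda>_. 0)"
  let ?B = "Local_Measurement B 2 (\<lambda>_. d) (undo_op B d V) (\<lambda>k. if k = 0 then p' else ?fail)"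
  let ?A = "Local_Measurement A 2 (\<lambda>_. d) (undo_op A d W) (\<lambda>k. if k = 0 then ?B else ?fail)"
  have v_eq: "(\<lambda>r. act n B d d (undo_op B d V 0) (vA 0 r)) = v"
    by (rule ext) (simp add: v_def vA_def undo_op_def)
  have "identifies n {A, B} R ?B d (vA 0)"
    unfolding identifies.simps(2)
  proof (intro conjI allI impI)
    show "measurement B d 2 (\<lambda>_. d) (undo_op B d V)"
      by (rule measurement_undo_op[OF fin(2) V])
    fix k :: nat assume "k < 2"
    then consider "k = 0" | "k = 1"
      by linarith
    then show "identifies n {A, B} R (if k = 0 then p' else ?fail) d
        (\<lambda>r. act n B d d (undo_op B d V k) (vA 0 r))"
    proof cases
      case 1
      show ?thesis
        unfolding 1 v_eq using p' by simp
    next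
      case 2
      show ?thesis
        unfolding 2 using V_fail by simp
    qed
  qed simp
  then have B: "identifies n {A, B} R ?B d (\<lambda>r. act n A d d (undo_op A d W 0) r)"
    by (simp only: vA_def[abs_def])
  have "identifies n {A, B} R ?A d (\<lambda>r. r)"
    unfolding identifies.simps(2)[of _ _ _ A]
  proof (intro conjI allI impI)
    show "measurement A d 2 (\<lambda>_. d) (undo_op A d W)"
      by (rule measurement_undo_op[OF fin(1) W])
    fix k :: nat assume "k < 2"
    then consider "k = 0" | "k = 1"
      by linarith
    then show "identifies n {A, B} R (if k = 0 then ?B else ?fail) d
        (\<lambda>r. act n A d d (undo_op A d W k) r)"
    proof cases
      case 1
      show ?thesis
        unfolding 1 using B by (simp only: refl if_True)
    next
      case 2
      show ?thesis
        unfolding 2 using W_fail[unfolded vA_def] by simp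
    qed
  qed simp
  then have "\<exists>p. identifies n {A, B} R p d (\<lambda>r. r)"
    by (intro exI[of _ ?A])
  then show ?thesis
    by (simp only: locally_distinguishable_def)
qed

end

theorem theorem9:
  fixes n :: nat and d :: "nat \<Rightarrow> nat" and S :: "ket set"
  assumes "3 \<le> n"
    and "\<forall>i<n. 3 \<le> d i"
    and "complete_orthogonal_product_basis n d S"
    and "locally_distinguishable n d (all_separated n) S"
  shows "strongly_local n d S"
  unfolding strongly_local_def
proof (intro conjI allI impI)
  show "3 \<le> n" "\<And>i. i < n \<Longrightarrow> 3 \<le> d i" "orthogonal_product_set n d S"
    using assms by (auto simp: complete_orthogonal_product_basis_def)
next
  fix A B assume AB: "bipartition n A B"
  obtain p where "identifies n (all_separated n) S p d (\<lambda>\<psi>. \<psi>)"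
    using assms(4) unfolding locally_distinguishable_def by blast
  \<comment> \<open>Each single party lies in \<open>A\<close> or in \<open>B\<close>, so the
    protocol of separated parties can be run with these coarser blocks.\<close>
  then have "\<exists>p'. identifies n {A, B} S p' d (\<lambda>\<psi>. \<psi>)"
  proof (rule identifies_transfer[where g = "\<lambda>\<psi>. \<psi>"])
    show "\<forall>G\<in>all_separated n. \<exists>G'\<in>{A, B}. G \<subseteq> G'" "\<forall>G'\<in>{A, B}. G' \<subseteq> {..<n}"
      using AB by (auto simp: bipartition_def all_separated_def)
    show "\<forall>r\<in>S. \<exists>\<phi>\<in>S. \<phi> = r \<and> (\<exists>a. r = (\<lambda>x. a * \<phi> x))"
      by (auto intro!: exI[of _ 1])
  qed
  then show dist: "locally_distinguishable n d {A, B} S"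
    by (simp add: locally_distinguishable_def)
  interpret bipartite_basis n d A B S
  proof
    show "A \<inter> B = {}" "A \<union> B = {..<n}"
      using AB by (auto simp: bipartition_def)
    show "finite S" "orthonormal n d S"
      using assms(3)
      by (auto simp: complete_orthogonal_product_basis_def orthogonal_product_set_def)
    show "\<exists>c. \<psi> = (\<lambda>x. \<Sum>\<phi>\<in>S. c \<phi> * \<phi> x)" if "\<psi> \<in> hilbert n d" for \<psi>
      using assms(3) that by (simp add: complete_orthogonal_product_basis_def)
  qed
  show "\<not> activable n d A B S"
    using distinguishable_reachable[OF reachable_remaining[OF reachable_start] dist]
    unfolding activable_def by blast
qed

end
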